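(* Let $d\ge2$, $\{r_n\}\subset(0,1)$ and $\{s_n\}\subset(1,+\infty)$ with $r_n\to0^+$ and $s_n\to1^+$. Let $\{E_n\}\subset\mathfrak{C}$ with $E_n\to E$ in $\mathfrak{C}$ for some $E\in\mathfrak{C}$. Then for every $x\in\partial E\cap\partial E_n$ for all $n$, $$\lim_{n\to\infty}\frac{\mathcal K^{s_n}_{r_n}(x,E_n)}{\beta(r_n,s_n)}=\omega_{d-1}\mathcal K^1(x,E).$$
   Context: $\mathfrak{C}$ is the class of subsets of $\mathbb{R}^d$ which are closures of open sets with compact $C^2$ boundary; $E_n\to E$ in $\mathfrak{C}$ means there are diffeomorphisms $\Phi_n$ converging to the identity in $C^2$ with $\Phi_n(E)=E_n$. $k^s_r(t)=r^{-d-s}$ for $0\le t\le r$ and $k^s_r(t)=t^{-d-s}$ for $t>r$; $\mathcal K^s_r(x,E):=\int_{\mathbb{R}^d}(\chi_{\mathbb{R}^d\setminus E}(y)-\chi_E(y))k^s_r(|x-y|)\,dy$. $\beta(r,s):=\frac{d+s}{d+1}\frac{r^{1-s}-1}{s-1}+\frac1{d+1}$. $\omega_{d-1}$ is the measure of the unit ball of $\mathbb{R}^{d-1}$; $\mathcal K^1$ is the classical scalar mean curvature (sum of principal curvatures, positive on balls). *)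

theory Defs
  imports "HOL-Analysis.Analysis"
begin

definition C2_on :: "'a::euclidean_space set \<Rightarrow> ('a \<Rightarrow> 'b::real_normed_vector) \<Rightarrow> bool" where
  "C2_on U f \<longleftrightarrow> (\<exists>(Df :: 'a \<Rightarrow> ('a \<Rightarrow>\<^sub>L 'b)) (D2f :: 'a \<Rightarrow> ('a \<Rightarrow>\<^sub>L ('a \<Rightarrow>\<^sub>L 'b))).
      (\<forall>y\<in>U. (f has_derivative blinfun_apply (Df y)) (at y)
            \<and> (Df has_derivative blinfun_apply (D2f y)) (at y))
      \<and> continuous_on U D2f)"

definition local_defining ::
  "'a::euclidean_space set \<Rightarrow> 'a \<Rightarrow> real \<Rightarrow> ('a \<Rightarrow> real) \<Rightarrow> ('a \<Rightarrow> ('a \<Rightarrow>\<^sub>L real))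
     \<Rightarrow> ('a \<Rightarrow> ('a \<Rightarrow>\<^sub>L ('a \<Rightarrow>\<^sub>L real))) \<Rightarrow> bool" where
  "local_defining E x \<rho> \<phi> D\<phi> D2\<phi> \<longleftrightarrow>
     \<rho> > 0
     \<and> (\<forall>y\<in>ball x \<rho>. (\<phi> has_derivative blinfun_apply (D\<phi> y)) (at y)
                    \<and> (D\<phi> has_derivative blinfun_apply (D2\<phi> y)) (at y)
                    \<and> D\<phi> y \<noteq> 0)
     \<and> continuous_on (ball x \<rho>) D2\<phi>
     \<and> E \<inter> ball x \<rho> = {y \<in> ball x \<rho>. \<phi> y \<le> 0}"

definition classC :: "'a::euclidean_space set set" where
  "classC = {E. (\<exists>U. open U \<and> E = closure U) \<and> compact (frontier E)
               \<and> (\<forall>x\<in>frontier E. \<exists>\<rho> \<phi> D\<phi> D2\<phi>. local_defining E x \<rho> \<phi> D\<phi> D2\<phi>)}"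

definition gradient_of :: "('a::euclidean_space \<Rightarrow>\<^sub>L real) \<Rightarrow> 'a" where
  "gradient_of L = (\<Sum>b\<in>Basis. blinfun_apply L b *\<^sub>R b)"

text \<open>Scalar mean curvature (sum of principal curvatures) computed from a defining function:
  trace of the Hessian projected on the tangent space, divided by the gradient length,
  i.e. div (grad phi / |grad phi|); positive on balls.\<close>
definition curv_formula :: "('a::euclidean_space \<Rightarrow>\<^sub>L real) \<Rightarrow> ('a \<Rightarrow>\<^sub>L ('a \<Rightarrow>\<^sub>L real)) \<Rightarrow> real" where
  "curv_formula D H =
     (let g = gradient_of D; \<nu> = (1 / norm g) *\<^sub>R g in
       ((\<Sum>b\<in>Basis. blinfun_apply (blinfun_apply H b) b) - blinfun_apply (blinfun_apply H \<nu>) \<nu>) / norm g)"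

definition mean_curv :: "'a::euclidean_space \<Rightarrow> 'a set \<Rightarrow> real" where
  "mean_curv x E = (SOME K. \<exists>\<rho> \<phi> D\<phi> D2\<phi>. local_defining E x \<rho> \<phi> D\<phi> D2\<phi>
                              \<and> K = curv_formula (D\<phi> x) (D2\<phi> x))"

definition convC :: "(nat \<Rightarrow> 'a::euclidean_space set) \<Rightarrow> 'a set \<Rightarrow> bool" where
  "convC En E \<longleftrightarrow>
     (\<exists>(\<Phi> :: nat \<Rightarrow> 'a \<Rightarrow> 'a) (D\<Phi> :: nat \<Rightarrow> 'a \<Rightarrow> ('a \<Rightarrow>\<^sub>L 'a)) (D2\<Phi> :: nat \<Rightarrow> 'a \<Rightarrow> ('a \<Rightarrow>\<^sub>L ('a \<Rightarrow>\<^sub>L 'a))).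
        (\<forall>n. bij (\<Phi> n) \<and> C2_on UNIV (inv (\<Phi> n))
             \<and> (\<forall>y. (\<Phi> n has_derivative blinfun_apply (D\<Phi> n y)) (at y)
                  \<and> (D\<Phi> n has_derivative blinfun_apply (D2\<Phi> n y)) (at y))
             \<and> continuous_on UNIV (D2\<Phi> n)
             \<and> \<Phi> n ` E = En n)
      \<and> (\<forall>\<epsilon>>0. \<forall>\<^sub>F n in sequentially. \<forall>y.
            norm (\<Phi> n y - y) \<le> \<epsilon> \<and> norm (D\<Phi> n y - id_blinfun) \<le> \<epsilon> \<and> norm (D2\<Phi> n y) \<le> \<epsilon>))"

definition kern :: "nat \<Rightarrow> real \<Rightarrow> real \<Rightarrow> real \<Rightarrow> real" where
  "kern d s r t = (if t \<le> r then r powr (-(real d + s)) else t powr (-(real d + s)))"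

definition Kcurv :: "real \<Rightarrow> real \<Rightarrow> 'a::euclidean_space \<Rightarrow> 'a set \<Rightarrow> real" where
  "Kcurv s r x E = (\<integral>y. (indicator (- E) y - indicator E y) * kern DIM('a) s r (norm (x - y)) \<partial>lborel)"

definition beta :: "nat \<Rightarrow> real \<Rightarrow> real \<Rightarrow> real" where
  "beta d r s = (real d + s) / (real d + 1) * ((r powr (1 - s) - 1) / (s - 1)) + 1 / (real d + 1)"

end

theory Submission
  imports Defs
begin

text \<open>
  Writing \<open>p = d + s\<close>, the truncated kernel is the superposition
  \<open>k(t) = \<integral>\<^sub>r\<^sup>\<infinity> p u\<^bsup>-p-1\<^esup> 1[t \<le> u] du\<close> of indicators of balls. Hence the nonlocal curvature is
  \<open>\<integral>\<^sub>r\<^sup>\<infinity> p u\<^bsup>-p-1\<^esup> V(u) du\<close>, where \<open>V(u)\<close> is the volume of the part of the ball \<open>B\<^sub>u(x)\<close> outside the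
  set minus the volume of the part inside it. A second order expansion of the defining functions
  \<open>\<phi> \<circ> \<Phi>\<^sub>n\<^sup>-\<^sup>1\<close>, uniform in \<open>n\<close>, gives \<open>V(u) = (c + o(1)) u\<^bsup>d+1\<^esup>\<close> with \<open>c = \<omega>\<^bsub>d-1\<^esub> K\<^sup>1 / (d + 1)\<close>: on
  the line through a point \<open>y\<close> of the tangent hyperplane parallel to the normal, the half-space part
  cancels by symmetry and the quadratic part \<open>q\<close> contributes \<open>2 q(y)\<close>, which is integrated over the
  disc of radius \<open>u\<close>. Since \<open>p \<integral>\<^sub>r\<^sup>1 u\<^bsup>-s\<^esup> du = (d + 1) \<beta>(r,s) - 1\<close> and \<open>\<beta>(r,s) \<rightarrow> \<infinity>\<close>, the region where
  \<open>u\<close> is not small is negligible and the quotient tends to \<open>c (d + 1)\<close>.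
\<close>

subsection \<open>Lebesgue measure under orthogonal transformations\<close>

lemma sets_borel_cball [measurable]: "cball (c::'a::euclidean_space) r \<in> sets borel"
  by simp

lemma integrable_bounded_support:
  fixes f :: "'a::euclidean_space \<Rightarrow> real"
  assumes "sets M = sets borel" "emeasure M (cball c R) < \<infinity>" "f \<in> borel_measurable borel"
    and le: "\<And>z. \<bar>f z\<bar> \<le> B * indicator (cball c R) z"
  shows "integrable M f"
proof (rule Bochner_Integration.integrable_bound)
  show "integrable M (\<lambda>z. B * indicator (cball c R) z)"
    using assms(1,2) by (intro integrable_mult_right integrable_real_indicator) auto
  show "AE z in M. norm (f z) \<le> norm (B * indicator (cball c R) z)"
    using le by (auto intro!: AE_I2 order_trans[OF le])
  show "f \<in> borel_measurable M"
    using assms(3) by (simp add: measurable_cong_sets[OF assms(1) refl])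
qed

lemma nn_integral_translation:
  fixes f :: "'a::euclidean_space \<Rightarrow> ennreal"
  assumes "distr M borel ((+) c) = M" "sets M = sets borel"
    and [measurable]: "f \<in> borel_measurable borel"
  shows "(\<integral>\<^sup>+y. f (c + y) \<partial>M) = (\<integral>\<^sup>+y. f y \<partial>M)"
proof -
  have [measurable]: "(+) c \<in> M \<rightarrow>\<^sub>M borel"
    by (simp add: measurable_cong_sets[OF assms(2) refl])
  have "(\<integral>\<^sup>+y. f y \<partial>M) = (\<integral>\<^sup>+y. f y \<partial>distr M borel ((+) c))"
    by (simp only: assms(1))
  also have "\<dots> = (\<integral>\<^sup>+y. f (c + y) \<partial>M)"
    by (rule nn_integral_distr) simp_all
  finally show ?thesis ..
qed

lemmas nn_integral_lborel_translation = nn_integral_translation[OF lborel_distr_plus sets_lborel]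

text \<open>
  Applying Tonelli to \<open>1\<^sub>B(x) 1\<^sub>A(x + y)\<close> in both orders gives \<open>|B| M(A) = |A| M(B)\<close>.
\<close>

lemma lborel_eqI_translation_invariant:
  fixes M :: "'a::euclidean_space measure"
  assumes sets_M [measurable_cong]: "sets M = sets borel"
    and "sigma_finite_measure M"
    and invariant: "\<And>c. distr M borel ((+) c) = M"
    and unit_ball: "emeasure M (cball 0 1) = emeasure lborel (cball (0::'a) 1)"
  shows "M = lborel"
proof (rule measure_eqI)
  show "sets M = sets lborel" by (simp add: sets_M)
next
  interpret M: sigma_finite_measure M by fact
  interpret pair_sigma_finite lborel M ..
  note shift_M = nn_integral_translation[OF invariant sets_M]
  define B :: "'a set" where "B = cball 0 1"
  have [measurable]: "B \<in> sets borel" unfolding B_def by measurable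
  have B: "emeasure M B = emeasure lborel B" "emeasure lborel B \<noteq> 0" "emeasure lborel B \<noteq> \<infinity>"
    using unit_ball less_imp_neq[OF unit_ball_vol_pos[of "real DIM('a)"]]
    by (auto simp: B_def emeasure_cball)
  fix A assume "A \<in> sets M"
  then have [measurable]: "A \<in> sets borel" by (simp add: sets_M)
  have shift_B: "(\<integral>\<^sup>+x. indicator B x * indicator A (x + y) \<partial>lborel)
      = (\<integral>\<^sup>+x. indicator A x * indicator B (- x + y) \<partial>lborel)" for y
    by (subst (2) nn_integral_lborel_translation[symmetric, of _ y])
      (auto intro!: nn_integral_cong simp: B_def indicator_def add.commute)
  have "emeasure lborel B * emeasure M A
      = (\<integral>\<^sup>+x. indicator B x * (\<integral>\<^sup>+y. indicator A y \<partial>M) \<partial>lborel)"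
    by (simp add: nn_integral_multc sets_M)
  also have "\<dots> = (\<integral>\<^sup>+x. (\<integral>\<^sup>+y. indicator B x * indicator A (x + y) \<partial>M) \<partial>lborel)"
    using shift_M[of "indicator A"] by (simp add: nn_integral_cmult)
  also have "\<dots> = (\<integral>\<^sup>+y. (\<integral>\<^sup>+x. indicator A x * indicator B (- x + y) \<partial>lborel) \<partial>M)"
    by (subst Fubini'[symmetric]) (simp_all add: shift_B)
  also have "\<dots> = (\<integral>\<^sup>+x. (\<integral>\<^sup>+y. indicator A x * indicator B (- x + y) \<partial>M) \<partial>lborel)"
    by (subst Fubini') simp_all
  also have "\<dots> = emeasure lborel A * emeasure M B"
    using shift_M[of "indicator B" "- x" for x]
    by (simp add: nn_integral_cmult nn_integral_multc sets_M)
  finally show "emeasure M A = emeasure lborel A"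
    using B ennreal_mult_cancel_left[of "emeasure lborel B"]
    by (metis mult.commute infinity_ennreal_def)
qed

lemma sigma_finite_measureI_cball:
  fixes M :: "'a::euclidean_space measure"
  assumes "sets M = sets borel" and "\<And>r. emeasure M (cball 0 r) < \<infinity>"
  shows "sigma_finite_measure M"
proof
  let ?A = "range (\<lambda>n. cball (0::'a) (real n))"
  have "\<Union> ?A = space M"
    using sets_eq_imp_space_eq[OF assms(1)] by (auto simp: real_arch_simple)
  moreover have "\<forall>a\<in>?A. emeasure M a \<noteq> \<infinity>"
    using assms(2) by (auto simp: less_top)
  ultimately show "\<exists>A. countable A \<and> A \<subseteq> sets M \<and> \<Union> A = space M \<and> (\<forall>a\<in>A. emeasure M a \<noteq> \<infinity>)"
    by (intro exI[of _ ?A]) (auto simp: assms(1))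
qed

lemma borel_measurable_orthogonal_transformation:
  fixes f :: "'a::euclidean_space \<Rightarrow> 'a"
  shows "orthogonal_transformation f \<Longrightarrow> f \<in> borel \<rightarrow>\<^sub>M borel"
  by (intro borel_measurable_continuous_onI linear_continuous_on)
    (simp add: linear_linear orthogonal_transformation_linear)

lemma distr_lborel_orthogonal_transformation:
  fixes f :: "'a::euclidean_space \<Rightarrow> 'a"
  assumes f: "orthogonal_transformation f"
  shows "distr lborel borel f = lborel"
proof (rule lborel_eqI_translation_invariant)
  let ?M = "distr lborel borel f"
  have [measurable]: "f \<in> borel \<rightarrow>\<^sub>M borel"
    by (rule borel_measurable_orthogonal_transformation[OF f])
  have ball: "emeasure ?M (cball 0 r) = emeasure lborel (cball (0::'a) r)" for r
    by (subst emeasure_distr)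
      (auto intro!: arg_cong[where f = "emeasure lborel"]
          simp: orthogonal_transformation_norm[OF f])
  show "emeasure ?M (cball 0 1) = emeasure lborel (cball (0::'a) 1)" by (rule ball)
  show "sigma_finite_measure ?M"
    by (rule sigma_finite_measureI_cball)
      (simp_all add: ball emeasure_bounded_finite[unfolded infinity_ennreal_def])
  fix c :: 'a
  obtain c' where c: "c = f c'"
    using orthogonal_transformation_surj[OF f] by blast
  have "distr ?M borel ((+) c) = distr lborel borel ((+) c \<circ> f)"
    by (subst distr_distr) simp_all
  also have "(+) c \<circ> f = f \<circ> (+) c'"
    by (auto simp: c linear_add[OF orthogonal_transformation_linear[OF f]])
  also have "distr lborel borel \<dots> = distr (distr lborel borel ((+) c')) borel f"
    by (subst distr_distr) simp_all
  finally show "distr ?M borel ((+) c) = ?M"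
    by (simp add: lborel_distr_plus)
qed simp

lemma nn_integral_lborel_scaleR:
  fixes f :: "'a::euclidean_space \<Rightarrow> ennreal"
  assumes [measurable]: "f \<in> borel_measurable borel" and "c \<noteq> 0"
  shows "(\<integral>\<^sup>+z. f z \<partial>lborel) = ennreal (\<bar>c\<bar> ^ DIM('a)) * (\<integral>\<^sup>+z. f (c *\<^sub>R z) \<partial>lborel)"
proof -
  have "(\<integral>\<^sup>+z. f z \<partial>lborel)
      = (\<integral>\<^sup>+z. f z \<partial>density (distr lborel borel (\<lambda>z. 0 + c *\<^sub>R z)) (\<lambda>_. \<bar>c\<bar> ^ DIM('a)))"
    by (simp only: lborel_affine[OF assms(2), of 0, symmetric])
  also have "\<dots> = ennreal (\<bar>c\<bar> ^ DIM('a)) * (\<integral>\<^sup>+z. f (c *\<^sub>R z) \<partial>lborel)"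
    by (simp add: nn_integral_density nn_integral_distr nn_integral_cmult)
  finally show ?thesis .
qed

definition reflect :: "'a::real_inner \<Rightarrow> 'a \<Rightarrow> 'a"
  where "reflect w z = z - (2 * (z \<bullet> w) / (w \<bullet> w)) *\<^sub>R w"

lemma orthogonal_transformation_reflect: "orthogonal_transformation (reflect w)"
  unfolding orthogonal_transformation_def
proof (intro conjI allI)
  show "linear (reflect w)"
    unfolding reflect_def
    by (rule linearI) (auto simp: algebra_simps inner_add_left add_divide_distrib)
  fix y z :: 'a
  define c where "c = 2 / (w \<bullet> w)"
  have c: "c * (c * (w \<bullet> w)) = 2 * c" by (simp add: c_def)
  have reflect: "reflect w v = v - (c * (v \<bullet> w)) *\<^sub>R w" for v
    by (simp add: reflect_def c_def)
  have "reflect w y \<bullet> reflect w z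
      = y \<bullet> z - 2 * c * (y \<bullet> w) * (z \<bullet> w) + c * (c * (w \<bullet> w)) * (y \<bullet> w) * (z \<bullet> w)"
    unfolding reflect
    by (simp add: inner_diff_left inner_diff_right inner_commute[of w y] inner_commute[of w z]
        algebra_simps)
  then show "reflect w y \<bullet> reflect w z = y \<bullet> z"
    by (simp add: c)
qed

lemma reflect_orthogonal: "z \<bullet> w = 0 \<Longrightarrow> reflect w z = z"
  by (simp add: reflect_def)

lemma reflect_swap:
  assumes "norm a = norm b"
  shows "reflect (a - b) a = b"
proof (cases "a = b")
  case False
  have "a \<bullet> a = b \<bullet> b" using assms by (simp add: norm_eq)
  then have "(a - b) \<bullet> (a - b) = 2 * (a \<bullet> (a - b))"
    by (simp add: inner_diff_left inner_diff_right inner_commute)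
  moreover have "(a - b) \<bullet> (a - b) \<noteq> 0" using False by simp
  ultimately have "2 * (a \<bullet> (a - b)) / ((a - b) \<bullet> (a - b)) = 1"
    by (metis divide_self)
  then have "(2 * (a \<bullet> (a - b)) / ((a - b) \<bullet> (a - b))) *\<^sub>R (a - b) = a - b"
    by (simp only: scaleR_one)
  then show ?thesis unfolding reflect_def by (simp only: diff_diff_eq2 add_diff_cancel_left')
qed (simp add: reflect_def)

subsection \<open>Lebesgue measure on hyperplanes\<close>

definition hyperplane_proj :: "'a::real_inner \<Rightarrow> 'a \<Rightarrow> 'a"
  where "hyperplane_proj \<nu> z = z - (z \<bullet> \<nu>) *\<^sub>R \<nu>"

text \<open>
  Measuring a subset of the hyperplane orthogonal to a unit vector by the volume of the cylinder of
  height 1 above it avoids choosing a basis of the hyperplane.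
\<close>

definition hyperplane_measure :: "'a::euclidean_space \<Rightarrow> 'a measure"
  where "hyperplane_measure \<nu> =
    distr (density lborel (indicator {z. 0 \<le> z \<bullet> \<nu> \<and> z \<bullet> \<nu> \<le> 1})) borel (hyperplane_proj \<nu>)"

lemma borel_measurable_hyperplane_proj [measurable]:
  "hyperplane_proj (\<nu>::'a::euclidean_space) \<in> borel \<rightarrow>\<^sub>M borel"
  unfolding hyperplane_proj_def by measurable

lemma hyperplane_proj_orthogonal: "norm \<nu> = 1 \<Longrightarrow> hyperplane_proj \<nu> z \<bullet> \<nu> = 0"
  by (simp add: hyperplane_proj_def inner_diff_left norm_eq_1)

lemma hyperplane_proj_eq: "y \<bullet> \<nu> = 0 \<Longrightarrow> norm \<nu> = 1 \<Longrightarrow> hyperplane_proj \<nu> (y + h *\<^sub>R \<nu>) = y"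
  by (simp add: hyperplane_proj_def inner_add_left norm_eq_1)

lemma norm_add_normal_sq:
  assumes "y \<bullet> \<nu> = 0" "norm \<nu> = 1"
  shows "(norm (y + h *\<^sub>R \<nu>))\<^sup>2 = (norm y)\<^sup>2 + h\<^sup>2"
  using assms norm_add_Pythagorean[of y "h *\<^sub>R \<nu>"] by (simp add: orthogonal_def)

lemma sum_squares_le_iff:
  fixes a b u :: real
  assumes "0 \<le> u"
  shows "a\<^sup>2 + b\<^sup>2 \<le> u\<^sup>2 \<longleftrightarrow> \<bar>a\<bar> \<le> u \<and> \<bar>b\<bar> \<le> sqrt (u\<^sup>2 - a\<^sup>2)"
proof -
  have "a\<^sup>2 + b\<^sup>2 \<le> u\<^sup>2 \<longleftrightarrow> b\<^sup>2 \<le> u\<^sup>2 - a\<^sup>2" by linarith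
  also have "\<dots> \<longleftrightarrow> a\<^sup>2 \<le> u\<^sup>2 \<and> b\<^sup>2 \<le> u\<^sup>2 - a\<^sup>2" using zero_le_power2[of b] by linarith
  also have "\<dots> \<longleftrightarrow> \<bar>a\<bar> \<le> u \<and> \<bar>b\<bar> \<le> sqrt (u\<^sup>2 - a\<^sup>2)"
    using assms
    by (simp add: real_sqrt_le_iff[of "b\<^sup>2", symmetric] abs_le_square_iff[of a u, symmetric])
  finally show ?thesis .
qed

lemma norm_add_normal_le_iff:
  assumes "y \<bullet> \<nu> = 0" "norm \<nu> = 1" "0 \<le> u"
  shows "norm (y + h *\<^sub>R \<nu>) \<le> u \<longleftrightarrow> (norm y)\<^sup>2 + h\<^sup>2 \<le> u\<^sup>2"
  using abs_le_square_iff[of "norm (y + h *\<^sub>R \<nu>)" u] assms by (simp add: norm_add_normal_sq)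

lemma norm_hyperplane_proj_sq:
  assumes "norm \<nu> = 1"
  shows "(norm (hyperplane_proj \<nu> z))\<^sup>2 = (norm z)\<^sup>2 - (z \<bullet> \<nu>)\<^sup>2"
  using norm_add_normal_sq[OF hyperplane_proj_orthogonal, OF assms assms, of z "z \<bullet> \<nu>"]
  by (simp add: hyperplane_proj_def)

lemma sets_hyperplane_measure [simp, measurable_cong]: "sets (hyperplane_measure \<nu>) = sets borel"
  by (simp add: hyperplane_measure_def)

lemma AE_hyperplane_measure: "norm \<nu> = 1 \<Longrightarrow> AE y in hyperplane_measure \<nu>. y \<bullet> \<nu> = 0"
  unfolding hyperplane_measure_def
  by (subst AE_distr_iff) (simp_all add: hyperplane_proj_orthogonal)

lemma nn_integral_hyperplane_measure:
  assumes [measurable]: "g \<in> borel_measurable borel"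
  shows "(\<integral>\<^sup>+y. g y \<partial>hyperplane_measure \<nu>)
    = (\<integral>\<^sup>+z. indicator {0..1} (z \<bullet> \<nu>) * g (hyperplane_proj \<nu> z) \<partial>lborel)"
  unfolding hyperplane_measure_def
  by (subst nn_integral_distr, simp, simp, subst nn_integral_density)
    (auto intro!: nn_integral_cong simp: indicator_def)

text \<open>
  Tonelli and two translations trade the cylinder of height 1 in the definition of the hyperplane
  measure for an interval of length 1 on each normal line.
\<close>

lemma nn_integral_slices:
  fixes f :: "'a::euclidean_space \<Rightarrow> ennreal"
  assumes "norm \<nu> = 1" and [measurable]: "f \<in> borel_measurable borel"
  shows "(\<integral>\<^sup>+z. f z \<partial>lborel) = (\<integral>\<^sup>+y. (\<integral>\<^sup>+h. f (y + h *\<^sub>R \<nu>) \<partial>lborel) \<partial>hyperplane_measure \<nu>)"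
proof -
  let ?I = "indicator {0..1} :: real \<Rightarrow> ennreal"
  have line: "(\<integral>\<^sup>+h. f (hyperplane_proj \<nu> z + h *\<^sub>R \<nu>) \<partial>lborel)
      = (\<integral>\<^sup>+h. f (z + h *\<^sub>R \<nu>) \<partial>lborel)" for z
    by (subst (2) nn_integral_lborel_translation[of _ "- (z \<bullet> \<nu>)", symmetric])
      (simp_all add: hyperplane_proj_def algebra_simps)
  have shift: "(\<integral>\<^sup>+z. ?I (z \<bullet> \<nu>) * f (z + h *\<^sub>R \<nu>) \<partial>lborel)
      = (\<integral>\<^sup>+z. ?I (z \<bullet> \<nu> - h) * f z \<partial>lborel)" for h
    using assms(1) nn_integral_lborel_translation[of "\<lambda>z. ?I (z \<bullet> \<nu> - h) * f z" "h *\<^sub>R \<nu>"]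
    by (simp add: inner_add_left norm_eq_1 add.commute)
  have unit: "(\<integral>\<^sup>+h. ?I (t - h) \<partial>lborel) = 1" for t
  proof -
    have "(\<integral>\<^sup>+h. ?I (t - h) \<partial>lborel) = (\<integral>\<^sup>+h. indicator {t - 1..t} h \<partial>lborel)"
      by (intro nn_integral_cong) (auto simp: indicator_def)
    then show ?thesis by simp
  qed
  have "(\<integral>\<^sup>+y. (\<integral>\<^sup>+h. f (y + h *\<^sub>R \<nu>) \<partial>lborel) \<partial>hyperplane_measure \<nu>)
      = (\<integral>\<^sup>+z. (\<integral>\<^sup>+h. ?I (z \<bullet> \<nu>) * f (z + h *\<^sub>R \<nu>) \<partial>lborel) \<partial>lborel)"
    by (subst nn_integral_hyperplane_measure) (simp_all add: line nn_integral_cmult)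
  also have "\<dots> = (\<integral>\<^sup>+h. (\<integral>\<^sup>+z. ?I (z \<bullet> \<nu>) * f (z + h *\<^sub>R \<nu>) \<partial>lborel) \<partial>lborel)"
    by (rule lborel_pair.Fubini') measurable
  also have "\<dots> = (\<integral>\<^sup>+h. (\<integral>\<^sup>+z. ?I (z \<bullet> \<nu> - h) * f z \<partial>lborel) \<partial>lborel)"
    by (simp only: shift)
  also have "\<dots> = (\<integral>\<^sup>+z. (\<integral>\<^sup>+h. ?I (z \<bullet> \<nu> - h) * f z \<partial>lborel) \<partial>lborel)"
    by (rule lborel_pair.Fubini') measurable
  also have "\<dots> = (\<integral>\<^sup>+z. f z \<partial>lborel)"
    by (simp add: nn_integral_multc unit)
  finally show ?thesis ..
qed

lemma emeasure_lborel_cylinder: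
  fixes \<nu> :: "'a::euclidean_space"
  assumes "norm \<nu> = 1" and [measurable]: "A \<in> sets borel" "I \<in> sets borel"
  shows "emeasure lborel {z. z \<bullet> \<nu> \<in> I \<and> hyperplane_proj \<nu> z \<in> A}
    = emeasure (hyperplane_measure \<nu>) A * emeasure lborel I"
proof -
  let ?C = "{z. z \<bullet> \<nu> \<in> I \<and> hyperplane_proj \<nu> z \<in> A}"
  have "emeasure lborel ?C = (\<integral>\<^sup>+z. indicator ?C z \<partial>lborel)" by simp
  also have "\<dots> = (\<integral>\<^sup>+y. (\<integral>\<^sup>+h. indicator ?C (y + h *\<^sub>R \<nu>) \<partial>lborel) \<partial>hyperplane_measure \<nu>)"
    by (rule nn_integral_slices[OF assms(1)]) measurable
  also have "\<dots> = (\<integral>\<^sup>+y. (\<integral>\<^sup>+h. indicator A y * indicator I h \<partial>lborel) \<partial>hyperplane_measure \<nu>)"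
    using AE_hyperplane_measure[OF assms(1)] assms(1)
    by (intro nn_integral_cong_AE, elim AE_mp)
      (auto intro!: nn_integral_cong AE_I2
          simp: indicator_def hyperplane_proj_eq inner_add_left norm_eq_1)
  also have "\<dots> = emeasure (hyperplane_measure \<nu>) A * emeasure lborel I"
    by (simp add: nn_integral_cmult nn_integral_multc)
  finally show ?thesis .
qed

lemma sigma_finite_hyperplane_measure:
  fixes \<nu> :: "'a::euclidean_space"
  assumes "norm \<nu> = 1"
  shows "sigma_finite_measure (hyperplane_measure \<nu>)"
proof (rule sigma_finite_measureI_cball)
  fix r :: real
  let ?C = "{z. z \<bullet> \<nu> \<in> {0..1} \<and> hyperplane_proj \<nu> z \<in> cball 0 r}"
  have "norm z \<le> r + 1" if "z \<in> ?C" for z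
  proof -
    have "norm z \<le> norm (hyperplane_proj \<nu> z) + norm ((z \<bullet> \<nu>) *\<^sub>R \<nu>)"
      using norm_triangle_ineq[of "hyperplane_proj \<nu> z" "(z \<bullet> \<nu>) *\<^sub>R \<nu>"]
      by (simp add: hyperplane_proj_def)
    then show ?thesis using that assms by auto
  qed
  then have "bounded ?C" by (auto simp: bounded_iff)
  then show "emeasure (hyperplane_measure \<nu>) (cball 0 r) < \<infinity>"
    using emeasure_lborel_cylinder[OF assms, of "cball 0 r" "{0..1}"] emeasure_bounded_finite[of ?C]
    by simp
qed simp

lemma integral_slices:
  fixes f :: "'a::euclidean_space \<Rightarrow> real"
  assumes "norm \<nu> = 1" and f: "integrable lborel f"
  shows "(\<integral>z. f z \<partial>lborel) = (\<integral>y. (\<integral>h. f (y + h *\<^sub>R \<nu>) \<partial>lborel) \<partial>hyperplane_measure \<nu>)"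
    and "integrable (hyperplane_measure \<nu>) (\<lambda>y. \<integral>h. f (y + h *\<^sub>R \<nu>) \<partial>lborel)"
proof -
  let ?H = "hyperplane_measure \<nu>" and ?T = "\<lambda>(y, h). y + h *\<^sub>R \<nu>"
  interpret sigma_finite_measure ?H by (rule sigma_finite_hyperplane_measure[OF assms(1)])
  interpret pair_sigma_finite ?H lborel ..
  have T [measurable]: "?T \<in> ?H \<Otimes>\<^sub>M lborel \<rightarrow>\<^sub>M borel" by measurable
  have lborel_eq: "lborel = distr (?H \<Otimes>\<^sub>M lborel) borel ?T"
  proof (rule measure_eqI)
    fix A :: "'a set" assume "A \<in> sets lborel"
    then have [measurable]: "A \<in> sets borel" by simp
    have "emeasure lborel A = (\<integral>\<^sup>+z. indicator A z \<partial>lborel)" by simp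
    also have "\<dots> = (\<integral>\<^sup>+p. indicator A (?T p) \<partial>(?H \<Otimes>\<^sub>M lborel))"
      by (subst nn_integral_slices[OF assms(1)]) (simp_all add: lborel.nn_integral_fst[symmetric])
    also have "\<dots> = (\<integral>\<^sup>+z. indicator A z \<partial>distr (?H \<Otimes>\<^sub>M lborel) borel ?T)"
      by (subst nn_integral_distr) simp_all
    finally show "emeasure lborel A = emeasure (distr (?H \<Otimes>\<^sub>M lborel) borel ?T) A" by simp
  qed simp
  have f_meas: "f \<in> borel_measurable borel" using f by auto
  have "integrable (distr (?H \<Otimes>\<^sub>M lborel) borel ?T) f"
    using f by (subst lborel_eq[symmetric])
  then have int: "integrable (?H \<Otimes>\<^sub>M lborel) (\<lambda>p. f (?T p))"
    by (simp add: integrable_distr_eq f_meas)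
  show "integrable ?H (\<lambda>y. \<integral>h. f (y + h *\<^sub>R \<nu>) \<partial>lborel)"
    using integrable_fst'[OF int] by simp
  have "(\<integral>z. f z \<partial>lborel) = (\<integral>z. f z \<partial>distr (?H \<Otimes>\<^sub>M lborel) borel ?T)"
    by (subst lborel_eq) (rule refl)
  also have "\<dots> = (\<integral>p. f (?T p) \<partial>(?H \<Otimes>\<^sub>M lborel))"
    by (rule integral_distr[OF T f_meas])
  finally show "(\<integral>z. f z \<partial>lborel) = (\<integral>y. (\<integral>h. f (y + h *\<^sub>R \<nu>) \<partial>lborel) \<partial>?H)"
    using integral_fst'[OF int] by simp
qed

lemma emeasure_hyperplane_cball_scale:
  fixes \<nu> :: "'a::euclidean_space"
  assumes "norm \<nu> = 1" "r > 0"
  shows "emeasure (hyperplane_measure \<nu>) (cball 0 r)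
    = ennreal (r ^ (DIM('a) - 1)) * emeasure (hyperplane_measure \<nu>) (cball 0 1)"
proof -
  let ?m = "\<lambda>r. emeasure (hyperplane_measure \<nu>) (cball 0 r)"
  let ?C = "\<lambda>r. {z. z \<bullet> \<nu> \<in> {0..r} \<and> hyperplane_proj \<nu> z \<in> cball 0 r}"
  have sets_C: "?C r \<in> sets lborel" for r by simp
  have cylinder: "emeasure lborel (?C r) = ennreal r * ?m r" if "r > 0" for r
    using emeasure_lborel_cylinder[OF assms(1), of "cball 0 r" "{0..r}"] that
    by (simp add: mult.commute)
  have scale: "r *\<^sub>R z \<in> ?C r \<longleftrightarrow> z \<in> ?C 1" for z
  proof -
    have "hyperplane_proj \<nu> (r *\<^sub>R z) = r *\<^sub>R hyperplane_proj \<nu> z"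
      by (simp add: hyperplane_proj_def scaleR_diff_right)
    then show ?thesis using assms(2) by (simp add: zero_le_mult_iff)
  qed
  have "ennreal r * ?m r = (\<integral>\<^sup>+z. indicator (?C r) z \<partial>lborel)"
    by (simp only: cylinder[OF assms(2)] nn_integral_indicator sets_C)
  also have "\<dots> = ennreal (r ^ DIM('a)) * (\<integral>\<^sup>+z. indicator (?C r) (r *\<^sub>R z) \<partial>lborel)"
    using assms(2) by (subst nn_integral_lborel_scaleR[of _ r]) auto
  also have "(\<lambda>z. indicator (?C r) (r *\<^sub>R z) :: ennreal) = indicator (?C 1)"
    by (rule ext) (simp only: indicator_def scale)
  also have "ennreal (r ^ DIM('a)) * (\<integral>\<^sup>+z. indicator (?C 1) z \<partial>lborel)
      = ennreal r * (ennreal (r ^ (DIM('a) - 1)) * ?m 1)"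
    using assms(2) cylinder[of 1] power_minus_mult[of "DIM('a)" r]
    by (simp add: ennreal_mult'[symmetric] mult.assoc[symmetric] mult.commute)
  finally show ?thesis
    using assms(2) by (subst (asm) ennreal_mult_cancel_left) auto
qed

lemma unit_ball_vol_add_1:
  assumes "0 \<le> x"
  shows "unit_ball_vol (x + 1) = Beta (1 / 2) (x / 2 + 1) * unit_ball_vol x"
  using assms by (auto simp: unit_ball_vol_def Beta_def Gamma_eq_zero_iff field_simps
      Gamma_one_half_real powr_half_sqrt[symmetric] powr_add[symmetric])

lemma emeasure_hyperplane_ball_section:
  fixes \<nu> :: "'a::euclidean_space"
  assumes "norm \<nu> = 1" "h \<noteq> 1" "h \<noteq> -1"
  shows "(\<integral>\<^sup>+y. indicator (cball 0 1) (y + h *\<^sub>R \<nu>) \<partial>hyperplane_measure \<nu>)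
    = emeasure (hyperplane_measure \<nu>) (cball 0 1)
      * ennreal (indicator {-1..1} h * sqrt (1 - h\<^sup>2) ^ (DIM('a) - 1))"
proof -
  let ?H = "hyperplane_measure \<nu>" and ?r = "sqrt (1 - h\<^sup>2)"
  have ball: "norm (y + h *\<^sub>R \<nu>) \<le> 1 \<longleftrightarrow> norm y \<le> ?r \<and> \<bar>h\<bar> \<le> 1" if "y \<bullet> \<nu> = 0" for y
    using norm_add_normal_le_iff[OF that assms(1), of 1 h] sum_squares_le_iff[of 1 h "norm y"]
    by (auto simp: add.commute)
  have "(\<integral>\<^sup>+y. indicator (cball 0 1) (y + h *\<^sub>R \<nu>) \<partial>?H)
      = (\<integral>\<^sup>+y. indicator (cball 0 ?r) y * indicator {-1..1} h \<partial>?H)"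
    using AE_hyperplane_measure[OF assms(1)]
    by (intro nn_integral_cong_AE, elim AE_mp, intro AE_I2)
      (auto simp: ball indicator_def abs_le_iff)
  also have "\<dots> = emeasure ?H (cball 0 ?r) * indicator {-1..1} h"
    by (simp add: nn_integral_multc[OF borel_measurable_indicator])
  also have "\<dots> = emeasure ?H (cball 0 1) * ennreal (indicator {-1..1} h * ?r ^ (DIM('a) - 1))"
  proof (cases "h \<in> {-1..1}")
    case True
    then have "h\<^sup>2 < 1" using assms(2,3) by (auto simp: abs_square_less_1)
    then show ?thesis
      using emeasure_hyperplane_cball_scale[OF assms(1), of ?r] True by (simp add: mult.commute)
  qed simp
  finally show ?thesis .
qed

lemma emeasure_hyperplane_cball:
  fixes \<nu> :: "'a::euclidean_space"
  assumes "norm \<nu> = 1" "r > 0"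
  shows "emeasure (hyperplane_measure \<nu>) (cball 0 r)
    = ennreal (unit_ball_vol (real (DIM('a) - 1)) * r ^ (DIM('a) - 1))"
proof -
  let ?H = "hyperplane_measure \<nu>" and ?k = "DIM('a) - 1"
  interpret sigma_finite_measure ?H
    by (rule sigma_finite_hyperplane_measure[OF assms(1)])
  interpret pair_sigma_finite lborel ?H ..
  define W where "W = emeasure ?H (cball 0 1)"
  define B where "B = Beta (1 / 2) (real ?k / 2 + 1)"
  have B: "unit_ball_vol (real DIM('a)) = B * unit_ball_vol (real ?k)"
    using unit_ball_vol_add_1[of "real ?k"] by (simp add: B_def of_nat_diff)
  have B_pos: "B > 0"
    by (rule zero_less_mult_pos2[of _ "unit_ball_vol (real ?k)"])
      (simp_all only: B[symmetric] unit_ball_vol_pos of_nat_0_le_iff)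
  have "ennreal (unit_ball_vol (real DIM('a)))
      = (\<integral>\<^sup>+z. indicator (cball 0 1) z \<partial>(lborel :: 'a measure))"
    by (simp add: emeasure_cball)
  also have "\<dots> = (\<integral>\<^sup>+y. (\<integral>\<^sup>+h. indicator (cball 0 1) (y + h *\<^sub>R \<nu>) \<partial>lborel) \<partial>?H)"
    by (rule nn_integral_slices[OF assms(1)]) measurable
  also have "\<dots> = (\<integral>\<^sup>+h. (\<integral>\<^sup>+y. indicator (cball 0 1) (y + h *\<^sub>R \<nu>) \<partial>?H) \<partial>lborel)"
    by (rule Fubini') measurable
  also have "\<dots> = (\<integral>\<^sup>+h. W * ennreal (indicator {-1..1} h * sqrt (1 - h\<^sup>2) ^ ?k) \<partial>lborel)"
  proof (rule nn_integral_cong_AE)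
    show "AE h in lborel. (\<integral>\<^sup>+y. indicator (cball 0 1) (y + h *\<^sub>R \<nu>) \<partial>?H)
        = W * ennreal (indicator {-1..1} h * sqrt (1 - h\<^sup>2) ^ ?k)"
      unfolding W_def using AE_lborel_singleton[of 1] AE_lborel_singleton[of "-1"]
      by eventually_elim (rule emeasure_hyperplane_ball_section[OF assms(1)])
  qed
  also have "\<dots> = W * ennreal B"
    unfolding B_def emeasure_cball_aux_integral[symmetric] by (rule nn_integral_cmult) measurable
  finally have "ennreal B * W = ennreal B * ennreal (unit_ball_vol (real ?k))"
    using B_pos by (simp add: B ennreal_mult' mult.commute)
  then have "W = ennreal (unit_ball_vol (real ?k))"
    using B_pos by (subst (asm) ennreal_mult_cancel_left) auto
  then show ?thesis
    using emeasure_hyperplane_cball_scale[OF assms] assms(2)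
    by (simp add: W_def[symmetric] ennreal_mult'' mult.commute)
qed

subsection \<open>Second moments of a disc\<close>

definition disc_moment :: "'a::euclidean_space \<Rightarrow> real \<Rightarrow> 'a \<Rightarrow> 'a \<Rightarrow> real"
  where "disc_moment \<nu> r v w =
    (\<integral>y. (y \<bullet> v) * (y \<bullet> w) * indicator (cball 0 r) y \<partial>hyperplane_measure \<nu>)"

lemma integrable_hyperplane_continuous:
  fixes f :: "'a::euclidean_space \<Rightarrow> real"
  assumes "norm \<nu> = 1" "r > 0" "continuous_on UNIV f"
  shows "integrable (hyperplane_measure \<nu>) (\<lambda>y. f y * indicator (cball 0 r) y)"
proof -
  have "bounded (f ` cball 0 r)"
    using assms(3)
    by (intro compact_imp_bounded compact_continuous_image continuous_on_subset[OF assms(3)]) auto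
  then obtain B where "\<And>y. y \<in> cball 0 r \<Longrightarrow> \<bar>f y\<bar> \<le> B"
    unfolding bounded_iff by (metis imageI real_norm_def)
  moreover have [measurable]: "f \<in> borel_measurable borel"
    using assms(3) by (rule borel_measurable_continuous_onI)
  ultimately show ?thesis
    using emeasure_hyperplane_cball[OF assms(1,2)]
    by (intro integrable_bounded_support[where B = B and c = 0 and R = r])
      (auto simp: indicator_def)
qed

lemma integral_hyperplane_cball:
  fixes \<nu> :: "'a::euclidean_space"
  assumes "norm \<nu> = 1" "r > 0"
  shows "(\<integral>y. indicator (cball 0 r) y \<partial>hyperplane_measure \<nu>)
    = unit_ball_vol (real (DIM('a) - 1)) * r ^ (DIM('a) - 1)"
  using emeasure_hyperplane_cball[OF assms] assms(2) by (simp add: measure_def)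

lemma ennreal_sq_diff_layer_cake:
  fixes y :: "'a::real_normed_vector"
  shows "ennreal (r\<^sup>2 - (norm y)\<^sup>2) * indicator (cball 0 r) y
    = (\<integral>\<^sup>+u. ennreal (2 * u) * indicator {0..r} u * indicator {y. norm y \<le> u} y \<partial>lborel)"
proof -
  have "(\<integral>\<^sup>+u. ennreal (2 * u) * indicator {0..r} u * indicator {y. norm y \<le> u} y \<partial>lborel)
      = (\<integral>\<^sup>+u. ennreal (2 * u) * indicator {norm y..r} u \<partial>lborel)"
    by (intro nn_integral_cong) (auto simp: indicator_def order_trans[OF norm_ge_zero])
  also have "\<dots> = ennreal (r\<^sup>2 - (norm y)\<^sup>2) * indicator (cball 0 r) y"
  proof (cases "norm y \<le> r")
    case True
    then have "(\<integral>\<^sup>+u. ennreal (2 * u) * indicator {norm y..r} u \<partial>lborel)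
        = ennreal (r\<^sup>2 - (norm y)\<^sup>2)"
      by (intro nn_integral_FTC_Icc)
        (auto intro!: derivative_eq_intros order_trans[OF norm_ge_zero])
    then show ?thesis using True by simp
  qed simp
  finally show ?thesis ..
qed

lemma nn_integral_power_Icc:
  fixes c r :: real
  assumes "0 \<le> c" "0 \<le> r"
  shows "(\<integral>\<^sup>+u. ennreal (c * u ^ n) * indicator {0..r} u \<partial>lborel)
      = ennreal (c * r ^ Suc n / real (Suc n))"
proof -
  have "(\<integral>\<^sup>+u. ennreal (c * u ^ n) * indicator {0..r} u \<partial>lborel)
      = ennreal (c / real (Suc n) * r ^ Suc n - c / real (Suc n) * 0 ^ Suc n)"
  proof (rule nn_integral_FTC_Icc)
    show "((\<lambda>u. c / real (Suc n) * u ^ Suc n) has_real_derivative c * u ^ n) (at u)" for u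
      using DERIV_cmult[OF DERIV_pow[of "Suc n" u UNIV], of "c / real (Suc n)"]
      by (simp del: of_nat_Suc power_Suc)
  qed (use assms in auto)
  then show ?thesis by simp
qed

lemma nn_integral_hyperplane_sq_diff:
  fixes \<nu> :: "'a::euclidean_space"
  assumes "norm \<nu> = 1" "r > 0"
  shows "(\<integral>\<^sup>+y. ennreal (r\<^sup>2 - (norm y)\<^sup>2) * indicator (cball 0 r) y \<partial>hyperplane_measure \<nu>)
    = ennreal (2 * unit_ball_vol (real (DIM('a) - 1)) * r ^ (DIM('a) + 1) / (real DIM('a) + 1))"
proof -
  let ?H = "hyperplane_measure \<nu>"
  define k where "k = DIM('a) - 1"
  define \<omega> where "\<omega> = unit_ball_vol (real k)"
  have \<omega>: "0 \<le> \<omega>" by (simp add: \<omega>_def)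
  interpret sigma_finite_measure ?H by (rule sigma_finite_hyperplane_measure[OF assms(1)])
  interpret pair_sigma_finite lborel ?H ..
  have disc: "(\<integral>\<^sup>+y. ennreal (2 * u) * indicator {0..r} u * indicator {y. norm y \<le> u} y \<partial>?H)
      = ennreal (2 * \<omega> * u ^ Suc k) * indicator {0..r} u" if "u \<noteq> 0" for u
  proof (cases "u \<in> {0..r}")
    case True
    have "(\<integral>\<^sup>+y. ennreal (2 * u) * indicator {0..r} u * indicator {y. norm y \<le> u} y \<partial>?H)
        = (\<integral>\<^sup>+y. ennreal (2 * u) * indicator (cball 0 u) y \<partial>?H)"
      using True by (intro nn_integral_cong) (simp add: indicator_def)
    also have "\<dots> = ennreal (2 * u) * ennreal (\<omega> * u ^ k)"
      using that True emeasure_hyperplane_cball[OF assms(1), of u]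
      by (subst nn_integral_cmult_indicator) (simp_all add: \<omega>_def k_def)
    also have "\<dots> = ennreal (2 * \<omega> * u ^ Suc k)"
      using True \<omega> by (simp add: ennreal_mult'[symmetric] mult_ac)
    finally show ?thesis using True by simp
  qed simp
  have "(\<integral>\<^sup>+y. ennreal (r\<^sup>2 - (norm y)\<^sup>2) * indicator (cball 0 r) y \<partial>?H)
      = (\<integral>\<^sup>+u. (\<integral>\<^sup>+y. ennreal (2 * u) * indicator {0..r} u * indicator {y. norm y \<le> u} y \<partial>?H) \<partial>lborel)"
    unfolding ennreal_sq_diff_layer_cake by (rule Fubini') measurable
  also have "\<dots> = (\<integral>\<^sup>+u. ennreal (2 * \<omega> * u ^ Suc k) * indicator {0..r} u \<partial>lborel)"
  proof (rule nn_integral_cong_AE)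
    show "AE u in lborel. (\<integral>\<^sup>+y. ennreal (2 * u) * indicator {0..r} u * indicator {y. norm y \<le> u} y \<partial>?H)
        = ennreal (2 * \<omega> * u ^ Suc k) * indicator {0..r} u"
      using AE_lborel_singleton[of 0] by eventually_elim (rule disc)
  qed
  also have "\<dots> = ennreal (2 * \<omega> * r ^ Suc (Suc k) / real (Suc (Suc k)))"
    using \<omega> assms(2) by (intro nn_integral_power_Icc) auto
  finally show ?thesis by (simp add: \<omega>_def k_def of_nat_diff mult_ac add.commute)
qed

lemma integral_hyperplane_norm_sq:
  fixes \<nu> :: "'a::euclidean_space"
  assumes "norm \<nu> = 1" "r > 0"
  shows "(\<integral>y. (norm y)\<^sup>2 * indicator (cball 0 r) y \<partial>hyperplane_measure \<nu>)
    = unit_ball_vol (real (DIM('a) - 1)) * r ^ (DIM('a) + 1) * (real DIM('a) - 1) / (real DIM('a) + 1)"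
proof -
  let ?H = "hyperplane_measure \<nu>" and ?d = "real DIM('a)"
  define \<omega> where "\<omega> = unit_ball_vol (real (DIM('a) - 1))"
  have deficit: "(\<integral>y. (r\<^sup>2 - (norm y)\<^sup>2) * indicator (cball 0 r) y \<partial>?H)
      = 2 * \<omega> * r ^ (DIM('a) + 1) / (?d + 1)"
    (is "integral\<^sup>L _ ?f = ?c")
  proof (rule integral_eq_nn_integral[THEN trans])
    have "(\<integral>\<^sup>+y. ennreal (?f y) \<partial>?H) = ennreal ?c"
      unfolding \<omega>_def nn_integral_hyperplane_sq_diff[OF assms, symmetric]
      by (intro nn_integral_cong) (simp add: indicator_def)
    then show "enn2real (\<integral>\<^sup>+y. ennreal (?f y) \<partial>?H) = ?c"
      using assms(2) by (simp add: \<omega>_def)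
  qed (use assms in \<open>auto simp: indicator_def power_mono\<close>)
  have disc: "(\<integral>y. r\<^sup>2 * indicator (cball 0 r) y \<partial>?H) = \<omega> * r ^ (DIM('a) + 1)"
  proof -
    have "r\<^sup>2 * r ^ (DIM('a) - 1) = r ^ (DIM('a) + 1)"
      by (simp add: power_add[symmetric])
    then show ?thesis
      by (simp only: integral_mult_right_zero integral_hyperplane_cball[OF assms] \<omega>_def
          mult.left_commute[of "r\<^sup>2"])
  qed
  have int: "integrable ?H (\<lambda>y. r\<^sup>2 * indicator (cball 0 r) y)"
    "integrable ?H (\<lambda>y. (r\<^sup>2 - (norm y)\<^sup>2) * indicator (cball 0 r) y)"
    by (intro integrable_hyperplane_continuous[OF assms] continuous_intros)+
  have "(\<integral>y. (norm y)\<^sup>2 * indicator (cball 0 r) y \<partial>?H)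
      = (\<integral>y. r\<^sup>2 * indicator (cball 0 r) y - (r\<^sup>2 - (norm y)\<^sup>2) * indicator (cball 0 r) y \<partial>?H)"
    by (simp add: algebra_simps)
  also have "\<dots> = \<omega> * r ^ (DIM('a) + 1) - 2 * \<omega> * r ^ (DIM('a) + 1) / (?d + 1)"
    by (simp only: Bochner_Integration.integral_diff[OF int] deficit disc)
  also have "\<dots> = \<omega> * r ^ (DIM('a) + 1) * (?d - 1) / (?d + 1)"
    by (simp add: divide_simps) (simp add: algebra_simps)
  finally show ?thesis unfolding \<omega>_def .
qed

lemma distr_hyperplane_measure_orthogonal_transformation:
  fixes f :: "'a::euclidean_space \<Rightarrow> 'a"
  assumes f: "orthogonal_transformation f"
  shows "distr (hyperplane_measure \<nu>) borel f = hyperplane_measure (f \<nu>)"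
proof -
  let ?slab = "\<lambda>\<nu>. indicator {z. 0 \<le> z \<bullet> \<nu> \<and> z \<bullet> \<nu> \<le> 1} :: 'a \<Rightarrow> ennreal"
  have [measurable]: "f \<in> borel \<rightarrow>\<^sub>M borel"
    by (rule borel_measurable_orthogonal_transformation[OF f])
  have inner: "f y \<bullet> f z = y \<bullet> z" for y z using f by (simp add: orthogonal_transformation_def)
  have proj: "f (hyperplane_proj \<nu> z) = hyperplane_proj (f \<nu>) (f z)" for z
    using orthogonal_transformation_linear[OF f]
    by (simp add: hyperplane_proj_def linear_diff linear_scale inner)
  have slab: "?slab (f \<nu>) (f z) = ?slab \<nu> z" for z by (simp add: indicator_def inner)
  have "distr (hyperplane_measure \<nu>) borel f
      = distr (density lborel (?slab \<nu>)) borel (\<lambda>z. hyperplane_proj (f \<nu>) (f z))"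
    by (simp add: hyperplane_measure_def distr_distr o_def proj)
  also have "\<dots>
      = distr (distr (density lborel (\<lambda>z. ?slab (f \<nu>) (f z))) borel f) borel (hyperplane_proj (f \<nu>))"
    by (simp add: distr_distr o_def slab)
  also have "distr (density lborel (\<lambda>z. ?slab (f \<nu>) (f z))) borel f = density lborel (?slab (f \<nu>))"
    using density_distr[of "?slab (f \<nu>)" borel f lborel]
    by (simp add: distr_lborel_orthogonal_transformation[OF f])
  finally show ?thesis by (simp add: hyperplane_measure_def)
qed

lemma disc_moment_orthogonal_transformation:
  fixes f :: "'a::euclidean_space \<Rightarrow> 'a"
  assumes f: "orthogonal_transformation f"
  shows "disc_moment (f \<nu>) r (f v) (f w) = disc_moment \<nu> r v w"
proof -
  have [measurable]: "f \<in> borel \<rightarrow>\<^sub>M borel"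
    by (rule borel_measurable_orthogonal_transformation[OF f])
  have "disc_moment (f \<nu>) r (f v) (f w)
      = (\<integral>y. (f y \<bullet> f v) * (f y \<bullet> f w) * indicator (cball 0 r) (f y) \<partial>hyperplane_measure \<nu>)"
    unfolding disc_moment_def distr_hyperplane_measure_orthogonal_transformation[OF f, symmetric]
    by (rule integral_distr) simp_all
  then show ?thesis
    using f
    by (simp add: disc_moment_def orthogonal_transformation_def orthogonal_transformation_norm[OF f]
        indicator_def)
qed

lemma disc_moment_eq_norm:
  assumes "v \<bullet> \<nu> = 0" "w \<bullet> \<nu> = 0" "norm v = norm w"
  shows "disc_moment \<nu> r v v = disc_moment \<nu> r w w"
proof -
  have "reflect (v - w) \<nu> = \<nu>"
    using assms(1,2) by (intro reflect_orthogonal) (simp add: inner_diff_right inner_commute)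
  then show ?thesis
    using disc_moment_orthogonal_transformation[OF orthogonal_transformation_reflect, of "v - w" \<nu> r v v]
    by (simp add: reflect_swap[OF assms(3)])
qed

lemma disc_moment_scaleR: "disc_moment \<nu> r (c *\<^sub>R v) (c *\<^sub>R v) = c\<^sup>2 * disc_moment \<nu> r v v"
  unfolding disc_moment_def integral_mult_right_zero[symmetric]
  by (simp add: power2_eq_square mult_ac)

lemma disc_moment_hyperplane_proj:
  assumes "norm \<nu> = 1"
  shows "disc_moment \<nu> r (hyperplane_proj \<nu> v) (hyperplane_proj \<nu> w) = disc_moment \<nu> r v w"
  unfolding disc_moment_def
proof (rule integral_cong_AE)
  show "AE y in hyperplane_measure \<nu>.
      (y \<bullet> hyperplane_proj \<nu> v) * (y \<bullet> hyperplane_proj \<nu> w) * indicator (cball 0 r) y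
      = (y \<bullet> v) * (y \<bullet> w) * indicator (cball 0 r) y"
    using AE_hyperplane_measure[OF assms]
    by eventually_elim (simp add: hyperplane_proj_def inner_diff_right)
qed measurable

lemma sum_norm_hyperplane_proj_Basis:
  fixes \<nu> :: "'a::euclidean_space"
  assumes "norm \<nu> = 1"
  shows "(\<Sum>i\<in>Basis. (norm (hyperplane_proj \<nu> i))\<^sup>2) = real DIM('a) - 1"
proof -
  have "(\<Sum>i\<in>Basis. (i \<bullet> \<nu>)\<^sup>2) = 1"
    using assms euclidean_inner[of \<nu> \<nu>] by (simp add: norm_eq_1 power2_eq_square inner_commute)
  then show ?thesis
    by (simp add: norm_hyperplane_proj_sq[OF assms] sum_subtractf)
qed

text \<open>
  The reflections fixing \<open>\<nu>\<close> show that \<open>disc_moment \<nu> r v v\<close> depends on \<open>v\<close> only through the length of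
  its tangential part; summing over a basis determines the constant.
\<close>

lemma disc_moment_diag:
  fixes \<nu> :: "'a::euclidean_space"
  assumes "norm \<nu> = 1" "r > 0" "DIM('a) \<ge> 2" "w \<bullet> \<nu> = 0"
  shows "disc_moment \<nu> r w w
      = unit_ball_vol (real (DIM('a) - 1)) * r ^ (DIM('a) + 1) / (real DIM('a) + 1) * (norm w)\<^sup>2"
proof -
  let ?P = "hyperplane_proj \<nu>" and ?d = "real DIM('a)"
  have moment: "(norm w)\<^sup>2 * disc_moment \<nu> r i i = (norm (?P i))\<^sup>2 * disc_moment \<nu> r w w" for i
    using disc_moment_eq_norm[of "norm w *\<^sub>R ?P i" \<nu> "norm (?P i) *\<^sub>R w" r] assms(4)
    by (simp add: hyperplane_proj_orthogonal[OF assms(1)] disc_moment_scaleR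
        disc_moment_hyperplane_proj[OF assms(1)])
  have "(?d - 1) * disc_moment \<nu> r w w = (\<Sum>i\<in>Basis. (norm w)\<^sup>2 * disc_moment \<nu> r i i)"
    by (simp add: moment sum_distrib_right[symmetric] sum_norm_hyperplane_proj_Basis[OF assms(1)])
  also have "\<dots> = (norm w)\<^sup>2 * (\<Sum>i\<in>Basis. disc_moment \<nu> r i i)"
    by (rule sum_distrib_left[symmetric])
  also have "(\<Sum>i\<in>Basis. disc_moment \<nu> r i i)
      = (\<integral>y. (norm y)\<^sup>2 * indicator (cball 0 r) y \<partial>hyperplane_measure \<nu>)"
  proof -
    have norm: "(norm y)\<^sup>2 = (\<Sum>i\<in>Basis. (y \<bullet> i) * (y \<bullet> i))" for y :: 'a
      by (simp add: power2_norm_eq_inner euclidean_inner[of y y])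
    have "integrable (hyperplane_measure \<nu>) (\<lambda>y. (y \<bullet> i) * (y \<bullet> i) * indicator (cball 0 r) y)" for i
      by (intro integrable_hyperplane_continuous[OF assms(1,2)] continuous_intros)
    then show ?thesis
      unfolding disc_moment_def norm sum_distrib_right
      by (subst Bochner_Integration.integral_sum) simp_all
  qed
  also have "\<dots> = (?d - 1) * (unit_ball_vol (real (DIM('a) - 1)) * r ^ (DIM('a) + 1) / (?d + 1))"
    by (simp add: integral_hyperplane_norm_sq[OF assms(1,2)])
  finally have "(?d - 1) * disc_moment \<nu> r w w
      = (?d - 1) * (unit_ball_vol (real (DIM('a) - 1)) * r ^ (DIM('a) + 1) / (?d + 1) * (norm w)\<^sup>2)"
    by (simp only: mult_ac)
  moreover have "?d - 1 \<noteq> 0" using assms(3) by simp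
  ultimately show ?thesis by (simp only: mult_cancel_left simp_thms)
qed

lemma disc_moment_eq:
  fixes \<nu> :: "'a::euclidean_space"
  assumes "norm \<nu> = 1" "r > 0" "DIM('a) \<ge> 2"
  shows "disc_moment \<nu> r v w
    = unit_ball_vol (real (DIM('a) - 1)) * r ^ (DIM('a) + 1) / (real DIM('a) + 1)
      * (v \<bullet> w - (v \<bullet> \<nu>) * (w \<bullet> \<nu>))"
proof -
  let ?P = "hyperplane_proj \<nu>" and ?M = "disc_moment \<nu> r"
  define c where "c = unit_ball_vol (real (DIM('a) - 1)) * r ^ (DIM('a) + 1) / (real DIM('a) + 1)"
  have diag: "?M v v = c * (norm (?P v))\<^sup>2" for v
    unfolding c_def
    using disc_moment_diag[OF assms hyperplane_proj_orthogonal[OF assms(1)]]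
    by (simp add: disc_moment_hyperplane_proj[OF assms(1)])
  have int: "integrable (hyperplane_measure \<nu>) (\<lambda>y. (y \<bullet> v) * (y \<bullet> w) * indicator (cball 0 r) y)" for v w
    by (intro integrable_hyperplane_continuous[OF assms(1,2)] continuous_intros)
  have "?M (v + w) (v + w) = ?M v v + 2 * ?M v w + ?M w w"
  proof -
    have "?M (v + w) (v + w) = (\<integral>y. (y \<bullet> v) * (y \<bullet> v) * indicator (cball 0 r) y
        + 2 * ((y \<bullet> v) * (y \<bullet> w) * indicator (cball 0 r) y)
        + (y \<bullet> w) * (y \<bullet> w) * indicator (cball 0 r) y \<partial>hyperplane_measure \<nu>)"
      unfolding disc_moment_def
      by (intro Bochner_Integration.integral_cong) (auto simp: inner_add_right algebra_simps)
    also have "\<dots> = ?M v v + 2 * ?M v w + ?M w w"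
      unfolding disc_moment_def by (simp add: int)
    finally show ?thesis .
  qed
  then have "2 * ?M v w = c * ((norm (?P (v + w)))\<^sup>2 - (norm (?P v))\<^sup>2 - (norm (?P w))\<^sup>2)"
    by (simp add: diag algebra_simps)
  also have "\<dots> = 2 * (c * (v \<bullet> w - (v \<bullet> \<nu>) * (w \<bullet> \<nu>)))"
    unfolding norm_hyperplane_proj_sq[OF assms(1)] unfolding power2_norm_eq_inner
    by (simp add: inner_add_left inner_add_right inner_commute power2_sum algebra_simps)
  finally show ?thesis by (simp add: c_def)
qed

definition tangential_trace :: "'a::euclidean_space \<Rightarrow> ('a \<Rightarrow>\<^sub>L 'a \<Rightarrow>\<^sub>L real) \<Rightarrow> real"
  where "tangential_trace \<nu> Q = (\<Sum>i\<in>Basis. Q i i) - Q \<nu> \<nu>"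

lemma blinfun2_expand:
  fixes Q :: "'a::euclidean_space \<Rightarrow>\<^sub>L 'a \<Rightarrow>\<^sub>L real"
  shows "Q v w = (\<Sum>i\<in>Basis. \<Sum>j\<in>Basis. (v \<bullet> i) * (w \<bullet> j) * Q i j)"
proof -
  have "Q v w = Q (\<Sum>i\<in>Basis. (v \<bullet> i) *\<^sub>R i) (\<Sum>j\<in>Basis. (w \<bullet> j) *\<^sub>R j)"
    by (simp add: euclidean_representation)
  also have "\<dots> = (\<Sum>i\<in>Basis. \<Sum>j\<in>Basis. (v \<bullet> i) * (w \<bullet> j) * Q i j)"
    by (subst sum.swap)
      (simp add: blinfun.sum_left blinfun.sum_right blinfun.scaleR_left blinfun.scaleR_right
          sum_distrib_left mult_ac)
  finally show ?thesis .
qed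

lemma integral_disc_quadratic_form:
  fixes \<nu> :: "'a::euclidean_space" and Q :: "'a \<Rightarrow>\<^sub>L 'a \<Rightarrow>\<^sub>L real"
  assumes "norm \<nu> = 1" "r > 0" "DIM('a) \<ge> 2"
  shows "(\<integral>y. Q y y * indicator (cball 0 r) y \<partial>hyperplane_measure \<nu>)
    = unit_ball_vol (real (DIM('a) - 1)) / (real DIM('a) + 1) * tangential_trace \<nu> Q * r ^ (DIM('a) + 1)"
proof -
  let ?H = "hyperplane_measure \<nu>"
  define c where "c = unit_ball_vol (real (DIM('a) - 1)) * r ^ (DIM('a) + 1) / (real DIM('a) + 1)"
  note moment = disc_moment_eq[OF assms, folded c_def]
  have int: "integrable ?H (\<lambda>y. (y \<bullet> i) * (y \<bullet> j) * indicator (cball 0 r) y)" for i j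
    by (intro integrable_hyperplane_continuous[OF assms(1,2)] continuous_intros)
  have trace: "(\<Sum>i\<in>Basis. \<Sum>j\<in>Basis. Q i j * (i \<bullet> j)) = (\<Sum>i\<in>Basis. Q i i)"
    by (intro sum.cong refl)
      (simp add: inner_Basis mult.commute[of "blinfun_apply _ _"] if_distrib[of "\<lambda>t. t * _"]
          cong: if_cong)
  have "(\<integral>y. Q y y * indicator (cball 0 r) y \<partial>?H)
      = (\<integral>y. (\<Sum>i\<in>Basis. \<Sum>j\<in>Basis. Q i j * ((y \<bullet> i) * (y \<bullet> j) * indicator (cball 0 r) y)) \<partial>?H)"
    by (subst blinfun2_expand) (simp add: sum_distrib_left sum_distrib_right mult_ac)
  also have "\<dots> = (\<Sum>i\<in>Basis. \<Sum>j\<in>Basis. Q i j * disc_moment \<nu> r i j)"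
    unfolding disc_moment_def by (simp add: int)
  also have "\<dots> = c * (\<Sum>i\<in>Basis. \<Sum>j\<in>Basis. Q i j * (i \<bullet> j) - (\<nu> \<bullet> i) * (\<nu> \<bullet> j) * Q i j)"
    by (simp add: moment sum_distrib_left inner_commute algebra_simps)
  also have "\<dots> = c * tangential_trace \<nu> Q"
    by (simp only: tangential_trace_def sum_subtractf blinfun2_expand[of Q \<nu> \<nu>, symmetric] trace)
  finally show ?thesis by (simp add: c_def)
qed

subsection \<open>Volume imbalance of balls\<close>

definition side :: "'a set \<Rightarrow> 'a \<Rightarrow> real"
  where "side S y = indicator (- S) y - indicator S y"

definition imbalance :: "'a::euclidean_space \<Rightarrow> 'a set \<Rightarrow> real \<Rightarrow> real"
  where "imbalance x S u = (\<integral>y. side S y * indicator (cball x u) y \<partial>lborel)"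

lemma abs_side [simp]: "\<bar>side S y\<bar> = 1"
  by (simp add: side_def indicator_def)

lemma borel_measurable_side [measurable]:
  assumes [measurable]: "S \<in> sets borel"
  shows "side S \<in> borel_measurable borel"
  unfolding side_def[abs_def] by measurable

lemma integrable_side_cball:
  fixes x :: "'a::euclidean_space"
  assumes "S \<in> sets borel"
  shows "integrable lborel (\<lambda>y. side S y * indicator (cball x u) y)"
  using assms by (intro integrable_bounded_support[where B = 1 and c = x and R = u])
    (auto simp: abs_mult emeasure_bounded_finite[unfolded infinity_ennreal_def])

lemma abs_imbalance_le:
  fixes x :: "'a::euclidean_space"
  assumes "S \<in> sets borel" "0 \<le> u"
  shows "\<bar>imbalance x S u\<bar> \<le> unit_ball_vol (real DIM('a)) * u ^ DIM('a)"
proof -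
  have "\<bar>imbalance x S u\<bar> \<le> (\<integral>y. \<bar>side S y * indicator (cball x u) y\<bar> \<partial>lborel)"
    unfolding imbalance_def by (rule integral_abs_bound)
  also have "\<dots> = (\<integral>y. indicator (cball x u) y \<partial>lborel)"
    by (simp add: abs_mult)
  finally show ?thesis using assms(2) by (simp add: content_cball)
qed

definition line_imbalance :: "'a::euclidean_space \<Rightarrow> 'a set \<Rightarrow> 'a \<Rightarrow> real \<Rightarrow> 'a \<Rightarrow> real"
  where "line_imbalance x S \<nu> u y =
    (\<integral>h. side S (x + (y + h *\<^sub>R \<nu>)) * indicator (cball 0 u) (y + h *\<^sub>R \<nu>) \<partial>lborel)"

lemma imbalance_eq_integral_line_imbalance:
  fixes x :: "'a::euclidean_space" and u :: real
  assumes [measurable]: "S \<in> sets borel" and \<nu>: "norm \<nu> = 1"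
  shows "imbalance x S u = (\<integral>y. line_imbalance x S \<nu> u y \<partial>hyperplane_measure \<nu>)"
    and "integrable (hyperplane_measure \<nu>) (line_imbalance x S \<nu> u)"
proof -
  have "imbalance x S u = (\<integral>y. side S y * indicator (cball x u) y \<partial>distr lborel borel ((+) x))"
    by (simp only: imbalance_def lborel_distr_plus)
  also have "\<dots> = (\<integral>z. side S (x + z) * indicator (cball x u) (x + z) \<partial>lborel)"
    by (rule integral_distr) simp_all
  finally have centered: "imbalance x S u = (\<integral>z. side S (x + z) * indicator (cball 0 u) z \<partial>lborel)"
    by (simp add: indicator_def dist_norm)
  have "integrable lborel (\<lambda>z. side S (x + z) * indicator (cball 0 u) z)"
    by (intro integrable_bounded_support[where B = 1 and c = 0 and R = u])
      (auto simp: abs_mult emeasure_bounded_finite[unfolded infinity_ennreal_def])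
  from integral_slices[OF \<nu> this]
  show "imbalance x S u = (\<integral>y. line_imbalance x S \<nu> u y \<partial>hyperplane_measure \<nu>)"
    and "integrable (hyperplane_measure \<nu>) (line_imbalance x S \<nu> u)"
    unfolding centered line_imbalance_def by auto
qed

text \<open>
  On \<open>[-l, l]\<close> the integrand lies between two step functions whose integrals are the values
  \<open>2 (a \<plusminus> e)\<close> clipped to \<open>[-2 l, 2 l]\<close>.
\<close>

lemma integral_side_interval:
  fixes A :: "real set"
  assumes A: "A \<in> sets borel" and l: "0 \<le> l" and e: "0 \<le> e" and a: "\<bar>a\<bar> \<le> m"
    and inside: "\<And>h. \<bar>h\<bar> \<le> l \<Longrightarrow> h + (a + e) < 0 \<Longrightarrow> h \<in> A"
    and outside: "\<And>h. \<bar>h\<bar> \<le> l \<Longrightarrow> h \<in> A \<Longrightarrow> h + (a - e) \<le> 0"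
  shows "\<bar>(\<integral>h. side A h * indicator {-l..l} h \<partial>lborel) - 2 * a\<bar>
      \<le> 2 * e + (if l < m then 2 * m else 0)"
proof -
  let ?s = "\<lambda>h. side A h * indicator {-l..l} h"
  let ?upper = "\<lambda>h. 2 * indicator {max (-l) (- (a + e))..l} h - indicator {-l..l} h :: real"
  let ?lower = "\<lambda>h. 2 * indicator {max (-l) (- (a - e))<..l} h - indicator {-l..l} h :: real"
  have "{-l..l} = cball 0 l" by (auto simp: dist_real_def)
  then have int: "integrable lborel ?s"
    using integrable_side_cball[OF A, of 0 l] by simp
  have "(\<integral>h. ?s h \<partial>lborel) \<le> (\<integral>h. ?upper h \<partial>lborel)"
  proof (rule integral_mono[OF int])
    show "?s h \<le> ?upper h" for h
      using inside[of h] by (auto simp: side_def indicator_def abs_le_iff)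
  qed (simp add: emeasure_lborel_Icc_eq)
  also have "\<dots> = 2 * max 0 (l - max (-l) (- (a + e))) - 2 * l"
    using l by (auto simp: max_def)
  also have "\<dots> \<le> 2 * a + (2 * e + (if l < m then 2 * m else 0))"
    using a e l by (auto simp: max_def)
  finally have upper: "(\<integral>h. ?s h \<partial>lborel) \<le> 2 * a + (2 * e + (if l < m then 2 * m else 0))" .
  have "2 * a - (2 * e + (if l < m then 2 * m else 0))
      \<le> 2 * max 0 (l - max (-l) (- (a - e))) - 2 * l"
    using a e l by (auto simp: max_def)
  also have "\<dots> = (\<integral>h. ?lower h \<partial>lborel)"
    using l by (auto simp: max_def)
  also have "\<dots> \<le> (\<integral>h. ?s h \<partial>lborel)"
  proof (rule integral_mono[OF _ int])
    show "?lower h \<le> ?s h" for h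
      using outside[of h] by (auto simp: side_def indicator_def abs_le_iff)
  qed (rule integrable_bounded_support[where B = 1 and c = 0 and R = l];
      auto simp: indicator_def dist_real_def emeasure_bounded_finite[unfolded infinity_ennreal_def])
  finally show ?thesis using upper by linarith
qed

definition quadric_approx ::
  "'a::euclidean_space set \<Rightarrow> 'a \<Rightarrow> real \<Rightarrow> real \<Rightarrow> ('a \<Rightarrow>\<^sub>L real) \<Rightarrow> ('a \<Rightarrow>\<^sub>L 'a \<Rightarrow>\<^sub>L real) \<Rightarrow> bool"
  where "quadric_approx S x \<delta> \<eta> D Q \<longleftrightarrow> (\<forall>z. norm z \<le> \<delta> \<longrightarrow>
    (D z + Q z z / 2 + \<eta> * (norm z)\<^sup>2 < 0 \<longrightarrow> x + z \<in> S) \<and>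
    (x + z \<in> S \<longrightarrow> D z + Q z z / 2 - \<eta> * (norm z)\<^sup>2 \<le> 0))"

lemma quadric_approx_mono: "quadric_approx S x \<delta> \<eta> D Q \<Longrightarrow> \<delta>' \<le> \<delta> \<Longrightarrow> quadric_approx S x \<delta>' \<eta> D Q"
  by (simp add: quadric_approx_def)

lemma abs_blinfun2_le:
  fixes Q :: "'a::real_normed_vector \<Rightarrow>\<^sub>L 'b::real_normed_vector \<Rightarrow>\<^sub>L real"
  shows "\<bar>Q v w\<bar> \<le> norm Q * norm v * norm w"
proof -
  have "\<bar>Q v w\<bar> \<le> norm (Q v) * norm w" using norm_blinfun[of "Q v" w] by simp
  also have "\<dots> \<le> norm Q * norm v * norm w"
    by (intro mult_right_mono norm_blinfun) simp
  finally show ?thesis .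
qed

lemma abs_quadratic_form_add_diff_le:
  fixes Q :: "'a::real_normed_vector \<Rightarrow>\<^sub>L 'a \<Rightarrow>\<^sub>L real"
  assumes "norm y \<le> u" "norm w \<le> u"
  shows "\<bar>Q (y + w) (y + w) - Q y y\<bar> \<le> 3 * norm Q * u * norm w"
proof -
  have "Q (y + w) (y + w) - Q y y = Q y w + Q w y + Q w w"
    by (simp add: blinfun.add_right blinfun.add_left)
  also have "\<bar>\<dots>\<bar> \<le> norm Q * norm y * norm w + norm Q * norm w * norm y + norm Q * norm w * norm w"
    using abs_blinfun2_le[of Q y w] abs_blinfun2_le[of Q w y] abs_blinfun2_le[of Q w w] by linarith
  also have "\<dots> = norm Q * norm w * (norm y + norm y + norm w)" by (simp add: algebra_simps)
  also have "\<dots> \<le> norm Q * norm w * (u + u + u)"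
    using assms by (intro mult_left_mono add_mono) auto
  finally show ?thesis by (simp add: mult_ac)
qed

lemma abs_quadratic_form_le:
  fixes Q :: "'a::real_normed_vector \<Rightarrow>\<^sub>L 'a \<Rightarrow>\<^sub>L real"
  assumes "norm Q / 2 + \<eta> \<le> m" "norm v \<le> u"
  shows "\<bar>Q v v / 2\<bar> + \<eta> * u\<^sup>2 \<le> m * u\<^sup>2"
proof -
  have "\<bar>Q v v\<bar> \<le> norm Q * norm v * norm v" by (rule abs_blinfun2_le)
  also have "\<dots> \<le> norm Q * u * u"
    using assms(2) order_trans[OF norm_ge_zero assms(2)] by (intro mult_mono) auto
  finally have "\<bar>Q v v / 2\<bar> + \<eta> * u\<^sup>2 \<le> (norm Q / 2 + \<eta>) * u\<^sup>2"
    by (simp add: power2_eq_square algebra_simps)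
  also have "\<dots> \<le> m * u\<^sup>2" using assms(1) by (intro mult_right_mono) auto
  finally show ?thesis .
qed

lemma abs_quadratic_form_normal_diff_le:
  fixes y \<nu> :: "'a::real_normed_vector" and Q :: "'a \<Rightarrow>\<^sub>L 'a \<Rightarrow>\<^sub>L real"
  assumes "norm \<nu> = 1" "norm Q / 2 \<le> m" "norm y \<le> u" "\<bar>h\<bar> \<le> u" "\<bar>h\<bar> \<le> m * u\<^sup>2"
  shows "\<bar>Q (y + h *\<^sub>R \<nu>) (y + h *\<^sub>R \<nu>) / 2 - Q y y / 2\<bar> \<le> 3 * m\<^sup>2 * u ^ 3"
proof -
  have nonneg: "0 \<le> u" "0 \<le> m"
    using order_trans[OF norm_ge_zero assms(3)] assms(2) norm_ge_zero[of Q] by linarith+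
  have "\<bar>Q (y + h *\<^sub>R \<nu>) (y + h *\<^sub>R \<nu>) - Q y y\<bar> \<le> 3 * norm Q * u * \<bar>h\<bar>"
    using abs_quadratic_form_add_diff_le[OF assms(3), of "h *\<^sub>R \<nu>" Q] assms(1,4) by simp
  then have "\<bar>Q (y + h *\<^sub>R \<nu>) (y + h *\<^sub>R \<nu>) / 2 - Q y y / 2\<bar> \<le> 3 * (norm Q / 2) * u * \<bar>h\<bar>"
    by (simp add: diff_divide_distrib[symmetric])
  also have "\<dots> \<le> 3 * m * u * (m * u\<^sup>2)"
    using assms(2,5) nonneg by (intro mult_mono) auto
  finally show ?thesis by (simp add: power2_eq_square power3_eq_cube mult_ac)
qed

lemma quadric_approx_normal_line:
  fixes x \<nu> y :: "'a::euclidean_space" and Q :: "'a \<Rightarrow>\<^sub>L 'a \<Rightarrow>\<^sub>L real"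
  assumes \<nu>: "norm \<nu> = 1" and \<eta>: "0 \<le> \<eta>" and u: "0 < u" and m: "norm Q / 2 + \<eta> \<le> m"
    and approx: "quadric_approx S x u \<eta> (blinfun_inner_right \<nu>) Q"
    and y: "y \<bullet> \<nu> = 0" "norm y \<le> u" and h: "norm (y + h *\<^sub>R \<nu>) \<le> u"
  defines "e \<equiv> \<eta> * u\<^sup>2 + 3 * m\<^sup>2 * u ^ 3"
  shows "h + (Q y y / 2 + e) < 0 \<Longrightarrow> x + (y + h *\<^sub>R \<nu>) \<in> S"
    and "x + (y + h *\<^sub>R \<nu>) \<in> S \<Longrightarrow> h + (Q y y / 2 - e) \<le> 0"
proof -
  define z where "z = y + h *\<^sub>R \<nu>"
  have z: "norm z \<le> u" "\<nu> \<bullet> z = h"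
    using h \<nu> y(1) by (simp_all add: z_def inner_add_right norm_eq_1 inner_commute)
  have e: "0 \<le> \<eta> * u\<^sup>2" "\<eta> * u\<^sup>2 \<le> e" using \<eta> u by (simp_all add: e_def)
  have \<eta>z: "\<eta> * (norm z)\<^sup>2 \<le> \<eta> * u\<^sup>2"
    using z(1) \<eta> by (intro mult_left_mono power_mono) auto
  have near: "\<bar>Q z z / 2 - Q y y / 2\<bar> \<le> 3 * m\<^sup>2 * u ^ 3" if "\<bar>h\<bar> \<le> m * u\<^sup>2"
    unfolding z_def using z Cauchy_Schwarz_ineq2[of \<nu> z] \<nu> \<eta> m y(2) that
    by (intro abs_quadratic_form_normal_diff_le) auto
  note bounds = abs_quadratic_form_le[OF m y(2)] abs_quadratic_form_le[OF m z(1)] e \<eta>z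
  show "x + (y + h *\<^sub>R \<nu>) \<in> S" if "h + (Q y y / 2 + e) < 0"
  proof -
    have "h + Q z z / 2 + \<eta> * (norm z)\<^sup>2 < 0"
    proof (cases "\<bar>h\<bar> \<le> m * u\<^sup>2")
      case True
      then show ?thesis using near that \<eta>z unfolding e_def by linarith
    next
      case False
      then show ?thesis using that bounds by linarith
    qed
    then show ?thesis using approx z by (simp add: quadric_approx_def z_def[symmetric])
  qed
  show "h + (Q y y / 2 - e) \<le> 0" if "x + (y + h *\<^sub>R \<nu>) \<in> S"
  proof -
    have outside: "h + Q z z / 2 - \<eta> * (norm z)\<^sup>2 \<le> 0"
      using approx z that unfolding quadric_approx_def z_def[symmetric] by auto
    show ?thesis
    proof (cases "\<bar>h\<bar> \<le> m * u\<^sup>2")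
      case True
      then show ?thesis using near outside \<eta>z unfolding e_def by linarith
    next
      case False
      then show ?thesis using outside bounds by linarith
    qed
  qed
qed

lemma line_imbalance_estimate:
  fixes x \<nu> y :: "'a::euclidean_space" and Q :: "'a \<Rightarrow>\<^sub>L 'a \<Rightarrow>\<^sub>L real"
  assumes S [measurable]: "S \<in> sets borel" and \<nu>: "norm \<nu> = 1" and \<eta>: "0 \<le> \<eta>"
    and u: "0 < u" "u * m < 1" and m: "norm Q / 2 + \<eta> \<le> m"
    and approx: "quadric_approx S x u \<eta> (blinfun_inner_right \<nu>) Q"
    and y: "y \<bullet> \<nu> = 0" "norm y \<le> u"
  shows "\<bar>line_imbalance x S \<nu> u y - Q y y\<bar>
    \<le> 2 * (\<eta> * u\<^sup>2 + 3 * m\<^sup>2 * u ^ 3) + (if u * (1 - u * m) < norm y then 2 * (m * u\<^sup>2) else 0)"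
proof -
  define l where "l = sqrt (u\<^sup>2 - (norm y)\<^sup>2)"
  define e where "e = \<eta> * u\<^sup>2 + 3 * m\<^sup>2 * u ^ 3"
  define A where "A = {h. x + (y + h *\<^sub>R \<nu>) \<in> S}"
  have m0: "0 \<le> m" using m \<eta> norm_ge_zero[of Q] by linarith
  have l: "0 \<le> l" "l\<^sup>2 = u\<^sup>2 - (norm y)\<^sup>2" using y(2) by (simp_all add: l_def power_mono)
  have line: "norm (y + h *\<^sub>R \<nu>) \<le> u \<longleftrightarrow> \<bar>h\<bar> \<le> l" for h
    using norm_add_normal_le_iff[OF y(1) \<nu>, of u h] sum_squares_le_iff[of u "norm y" h] u y
    by (simp add: l_def)
  have "side S (x + (y + h *\<^sub>R \<nu>)) * indicator (cball 0 u) (y + h *\<^sub>R \<nu>)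
      = side A h * indicator {-l..l} h" for h
    by (auto simp: side_def A_def indicator_def line)
  moreover have "\<bar>(\<integral>h. side A h * indicator {-l..l} h \<partial>lborel) - 2 * (Q y y / 2)\<bar>
      \<le> 2 * e + (if l < m * u\<^sup>2 then 2 * (m * u\<^sup>2) else 0)"
  proof (rule integral_side_interval)
    show "A \<in> sets borel" unfolding A_def by measurable
    show "0 \<le> e" using \<eta> m0 u by (simp add: e_def)
    show "\<bar>Q y y / 2\<bar> \<le> m * u\<^sup>2"
      using abs_quadratic_form_le[OF m y(2)] mult_nonneg_nonneg[OF \<eta> zero_le_power2[of u]]
      by linarith
    show "h \<in> A" if "\<bar>h\<bar> \<le> l" "h + (Q y y / 2 + e) < 0" for h
      using quadric_approx_normal_line(1)[OF \<nu> \<eta> u(1) m approx y] that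
      by (simp add: A_def line e_def)
    show "h + (Q y y / 2 - e) \<le> 0" if "\<bar>h\<bar> \<le> l" "h \<in> A" for h
      using quadric_approx_normal_line(2)[OF \<nu> \<eta> u(1) m approx y] that
      by (simp add: A_def line e_def)
  qed (rule l)
  moreover have "u * (1 - u * m) < norm y" if "l < m * u\<^sup>2"
  proof (rule ccontr)
    assume "\<not> ?thesis"
    then have "(norm y)\<^sup>2 \<le> (u * (1 - u * m))\<^sup>2" by (intro power_mono) auto
    also have "\<dots> = u\<^sup>2 - (m * u\<^sup>2)\<^sup>2 - 2 * u ^ 3 * m * (1 - u * m)"
      by (simp add: power2_eq_square power3_eq_cube algebra_simps)
    also have "\<dots> \<le> u\<^sup>2 - (m * u\<^sup>2)\<^sup>2" using u m0 by simp
    finally have "(m * u\<^sup>2)\<^sup>2 \<le> l\<^sup>2" using l by simp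
    then show False using power_strict_mono[OF that l(1), of 2] by simp
  qed
  moreover have "0 \<le> m * u\<^sup>2" using m0 by simp
  ultimately show ?thesis
    unfolding line_imbalance_def by (auto simp: e_def split: if_splits)
qed

lemma power_diff_scale_le:
  fixes u a :: real
  assumes "0 \<le> u" "0 \<le> a" "a \<le> 1"
  shows "u ^ k - (u * (1 - a)) ^ k \<le> real k * a * u ^ k"
proof -
  have "1 - (1 - a) ^ k \<le> real k * a"
    using Bernoulli_inequality[of "- a" k] assms by simp
  then have "u ^ k * (1 - (1 - a) ^ k) \<le> u ^ k * (real k * a)"
    using assms(1) by (intro mult_left_mono) auto
  then show ?thesis
    unfolding power_mult_distrib by (simp only: right_diff_distrib mult_1_right mult_ac)
qed

lemma line_imbalance_estimate_indicator:
  fixes x \<nu> y :: "'a::euclidean_space" and Q :: "'a \<Rightarrow>\<^sub>L 'a \<Rightarrow>\<^sub>L real"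
  assumes S: "S \<in> sets borel" and \<nu>: "norm \<nu> = 1" and \<eta>: "0 \<le> \<eta>"
    and u: "0 < u" "u * m < 1" and m: "norm Q / 2 + \<eta> \<le> m"
    and approx: "quadric_approx S x u \<eta> (blinfun_inner_right \<nu>) Q"
    and y: "y \<bullet> \<nu> = 0"
  shows "\<bar>line_imbalance x S \<nu> u y - Q y y * indicator (cball 0 u) y\<bar>
    \<le> 2 * (\<eta> * u\<^sup>2 + 3 * m\<^sup>2 * u ^ 3 + m * u\<^sup>2) * indicator (cball 0 u) y
      - 2 * (m * u\<^sup>2) * indicator (cball 0 (u * (1 - u * m))) y"
proof (cases "norm y \<le> u")
  case True
  then show ?thesis
    using line_imbalance_estimate[OF S \<nu> \<eta> u m approx y True]
    by (simp add: indicator_def algebra_simps split: if_splits)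
next
  case False
  then have "\<not> norm (y + h *\<^sub>R \<nu>) \<le> u" for h
    using norm_add_normal_le_iff[OF y \<nu>, of u h] sum_squares_le_iff[of u "norm y" h] u by simp
  moreover have "u * (1 - u * m) \<le> u"
    using u(1) order_trans[OF add_nonneg_nonneg m] \<eta> by (simp add: mult_left_le)
  ultimately show ?thesis using False by (simp add: line_imbalance_def)
qed

text \<open>
  The normal lines that leave the ball before they leave the transition zone \<open>|h| \<le> m u\<^sup>2\<close> lie in
  the small annulus \<open>u (1 - u m) < |y| \<le> u\<close>.
\<close>

lemma imbalance_estimate_normalized:
  fixes x \<nu> :: "'a::euclidean_space" and Q :: "'a \<Rightarrow>\<^sub>L 'a \<Rightarrow>\<^sub>L real"
  assumes d: "DIM('a) \<ge> 2" and S [measurable]: "S \<in> sets borel" and \<nu>: "norm \<nu> = 1" and \<eta>: "0 \<le> \<eta>"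
    and u: "0 < u" "u * m < 1" and m: "norm Q / 2 + \<eta> \<le> m"
    and approx: "quadric_approx S x u \<eta> (blinfun_inner_right \<nu>) Q"
  defines "\<omega> \<equiv> unit_ball_vol (real (DIM('a) - 1))"
  shows "\<bar>imbalance x S u - \<omega> / (real DIM('a) + 1) * tangential_trace \<nu> Q * u ^ (DIM('a) + 1)\<bar>
    \<le> 2 * \<omega> * (\<eta> + (real DIM('a) + 2) * m\<^sup>2 * u) * u ^ (DIM('a) + 1)"
proof -
  let ?H = "hyperplane_measure \<nu>"
  define \<rho> where "\<rho> = u * (1 - u * m)"
  define e where "e = \<eta> * u\<^sup>2 + 3 * m\<^sup>2 * u ^ 3"
  define err where "err y =
      2 * (e + m * u\<^sup>2) * indicator (cball 0 u) y - 2 * (m * u\<^sup>2) * indicator (cball 0 \<rho>) y" for y :: 'a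
  have m0: "0 \<le> m" using m \<eta> norm_ge_zero[of Q] by linarith
  have \<rho>: "0 < \<rho>" using u by (simp add: \<rho>_def)
  have int_disc: "integrable ?H (\<lambda>y. c * indicator (cball 0 t) y)" if "0 < t" for c t :: real
    by (intro integrable_hyperplane_continuous[OF \<nu> that] continuous_intros)
  have "imbalance x S u = (\<integral>y. line_imbalance x S \<nu> u y \<partial>?H)"
    and int_line: "integrable ?H (line_imbalance x S \<nu> u)"
    by (rule imbalance_eq_integral_line_imbalance[OF S \<nu>])+
  moreover have int_Q: "integrable ?H (\<lambda>y. Q y y * indicator (cball 0 u) y)"
    by (intro integrable_hyperplane_continuous[OF \<nu> u(1)] continuous_intros)
  ultimately have "\<bar>imbalance x S u - \<omega> / (real DIM('a) + 1) * tangential_trace \<nu> Q * u ^ (DIM('a) + 1)\<bar>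
      = \<bar>\<integral>y. line_imbalance x S \<nu> u y - Q y y * indicator (cball 0 u) y \<partial>?H\<bar>"
    by (simp only: Bochner_Integration.integral_diff \<omega>_def
        integral_disc_quadratic_form[OF \<nu> u(1) d])
  also have "\<dots> \<le> (\<integral>y. \<bar>line_imbalance x S \<nu> u y - Q y y * indicator (cball 0 u) y\<bar> \<partial>?H)"
    by (rule integral_abs_bound)
  also have "\<dots> \<le> (\<integral>y. err y \<partial>?H)"
  proof (rule integral_mono_AE)
    show "AE y in ?H. \<bar>line_imbalance x S \<nu> u y - Q y y * indicator (cball 0 u) y\<bar> \<le> err y"
      using AE_hyperplane_measure[OF \<nu>]
      by eventually_elim (simp only: err_def e_def \<rho>_def
          line_imbalance_estimate_indicator[OF S \<nu> \<eta> u m approx])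
  next
    show "integrable ?H err"
      unfolding err_def using \<rho> u(1) by (intro Bochner_Integration.integrable_diff int_disc)
  qed (intro integrable_abs Bochner_Integration.integrable_diff int_line int_Q)
  also have "\<dots>
      = 2 * e * \<omega> * u ^ (DIM('a) - 1) + 2 * (m * u\<^sup>2) * \<omega> * (u ^ (DIM('a) - 1) - \<rho> ^ (DIM('a) - 1))"
    unfolding err_def Bochner_Integration.integral_diff[OF int_disc[OF u(1)] int_disc[OF \<rho>]]
      integral_mult_right_zero integral_hyperplane_cball[OF \<nu> u(1)] integral_hyperplane_cball[OF \<nu> \<rho>]
    by (simp add: \<omega>_def algebra_simps)
  also have "\<dots>
      \<le> 2 * e * \<omega> * u ^ (DIM('a) - 1)
        + 2 * (m * u\<^sup>2) * \<omega> * (real (DIM('a) - 1) * (u * m) * u ^ (DIM('a) - 1))"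
    unfolding \<rho>_def \<omega>_def using m0 u
    by (intro add_left_mono mult_left_mono power_diff_scale_le) auto
  also have "\<dots> = 2 * \<omega> * (\<eta> + (real DIM('a) + 2) * m\<^sup>2 * u) * (u\<^sup>2 * u ^ (DIM('a) - 1))"
    using d by (simp add: e_def of_nat_diff power2_eq_square power3_eq_cube algebra_simps)
  also have "u\<^sup>2 * u ^ (DIM('a) - 1) = u ^ (DIM('a) + 1)"
    by (simp add: power_add[symmetric])
  finally show ?thesis .
qed

lemma inner_gradient_of: "blinfun_apply D z = gradient_of D \<bullet> z"
proof -
  have "blinfun_apply D z = blinfun_apply D (\<Sum>b\<in>Basis. (z \<bullet> b) *\<^sub>R b)"
    by (simp add: euclidean_representation)
  also have "\<dots> = gradient_of D \<bullet> z"
    unfolding gradient_of_def blinfun.sum_right inner_sum_left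
    by (intro sum.cong refl) (simp add: blinfun.scaleR_right inner_commute)
  finally show ?thesis .
qed

lemma gradient_of_eq_0_iff: "gradient_of D = 0 \<longleftrightarrow> D = 0"
proof
  assume "gradient_of D = 0"
  then show "D = 0" by (intro blinfun_eqI) (simp add: inner_gradient_of[of D])
qed (simp add: gradient_of_def)

lemma curv_formula_eq_tangential_trace:
  "curv_formula D Q
    = tangential_trace (sgn (gradient_of D)) Q / norm (gradient_of D)"
  by (simp add: curv_formula_def tangential_trace_def Let_def sgn_div_norm inverse_eq_divide)

lemma tangential_trace_scaleR: "tangential_trace \<nu> (c *\<^sub>R Q) = c * tangential_trace \<nu> Q"
  by (simp add: tangential_trace_def blinfun.scaleR_left sum_distrib_left right_diff_distrib)

lemma quadric_approx_scaleR:
  assumes "c > 0"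
  shows "quadric_approx S x \<delta> (c * \<eta>) (c *\<^sub>R D) (c *\<^sub>R Q) \<longleftrightarrow> quadric_approx S x \<delta> \<eta> D Q"
proof -
  have "(c *\<^sub>R D) z + (c *\<^sub>R Q) z z / 2 + c * \<eta> * (norm z)\<^sup>2
      = c * (D z + Q z z / 2 + \<eta> * (norm z)\<^sup>2)"
    "(c *\<^sub>R D) z + (c *\<^sub>R Q) z z / 2 - c * \<eta> * (norm z)\<^sup>2
        = c * (D z + Q z z / 2 - \<eta> * (norm z)\<^sup>2)" for z
    by (simp_all add: blinfun.scaleR_left algebra_simps)
  then show ?thesis
    using assms by (simp add: quadric_approx_def mult_less_0_iff mult_le_0_iff)
qed

definition imbalance_error ::
  "('a::euclidean_space \<Rightarrow>\<^sub>L real) \<Rightarrow> ('a \<Rightarrow>\<^sub>L 'a \<Rightarrow>\<^sub>L real) \<Rightarrow> real \<Rightarrow> real \<Rightarrow> real"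
  where "imbalance_error D Q \<eta> u = 2 * unit_ball_vol (real (DIM('a) - 1)) *
    (\<eta> / norm (gradient_of D) + (real DIM('a) + 2) * ((norm Q / 2 + \<eta>) / norm (gradient_of D))\<^sup>2 * u)"

lemma imbalance_estimate:
  fixes x :: "'a::euclidean_space" and D :: "'a \<Rightarrow>\<^sub>L real" and Q :: "'a \<Rightarrow>\<^sub>L 'a \<Rightarrow>\<^sub>L real"
  assumes d: "DIM('a) \<ge> 2" and S: "S \<in> sets borel" and D: "D \<noteq> 0" and \<eta>: "0 \<le> \<eta>"
    and approx: "quadric_approx S x u \<eta> D Q"
    and u: "0 < u" "u * ((norm Q / 2 + \<eta>) / norm (gradient_of D)) < 1"
  shows "\<bar>imbalance x S u / u ^ (DIM('a) + 1)
      - unit_ball_vol (real (DIM('a) - 1)) / (real DIM('a) + 1) * curv_formula D Q\<bar>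
    \<le> imbalance_error D Q \<eta> u"
proof -
  define \<omega> where "\<omega> = unit_ball_vol (real (DIM('a) - 1))"
  define \<kappa> where "\<kappa> = norm (gradient_of D)"
  define m where "m = (norm Q / 2 + \<eta>) / \<kappa>"
  define \<nu> where "\<nu> = sgn (gradient_of D)"
  define c where "c = \<omega> / (real DIM('a) + 1) * curv_formula D Q"
  define w where "w = u ^ (DIM('a) + 1)"
  have \<kappa>: "\<kappa> > 0" using D by (simp add: \<kappa>_def gradient_of_eq_0_iff)
  have \<nu>: "norm \<nu> = 1" using D by (simp add: \<nu>_def norm_sgn gradient_of_eq_0_iff)
  have "inverse \<kappa> *\<^sub>R D = blinfun_inner_right \<nu>"
    by (intro blinfun_eqI)
      (simp add: blinfun.scaleR_left inner_gradient_of[of D] \<nu>_def \<kappa>_def sgn_div_norm)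
  then have "quadric_approx S x u (\<eta> / \<kappa>) (blinfun_inner_right \<nu>) (inverse \<kappa> *\<^sub>R Q)"
    using quadric_approx_scaleR[of "inverse \<kappa>" S x u \<eta> D Q] approx \<kappa>
    by (simp add: divide_inverse_commute)
  moreover have "norm (inverse \<kappa> *\<^sub>R Q) / 2 + \<eta> / \<kappa> \<le> m"
    using \<kappa> by (simp add: m_def divide_simps)
  moreover have "tangential_trace \<nu> (inverse \<kappa> *\<^sub>R Q) = curv_formula D Q"
    by (simp add: tangential_trace_scaleR curv_formula_eq_tangential_trace \<nu>_def \<kappa>_def
        divide_inverse mult.commute)
  ultimately have "\<bar>imbalance x S u - c * w\<bar> \<le> imbalance_error D Q \<eta> u * w"
    using imbalance_estimate_normalized[OF d S \<nu> _ u(1) u(2)[folded \<kappa>_def m_def],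
        of "\<eta> / \<kappa>" "inverse \<kappa> *\<^sub>R Q" x] \<eta> \<kappa>
    by (simp add: imbalance_error_def c_def w_def m_def \<kappa>_def \<omega>_def)
  moreover have w: "w > 0" using u by (simp add: w_def)
  moreover have "imbalance x S u / w - c = (imbalance x S u - c * w) / w"
    using w by (simp add: diff_divide_distrib)
  ultimately have "\<bar>imbalance x S u / w - c\<bar> \<le> imbalance_error D Q \<eta> u"
    by (simp add: abs_divide pos_divide_le_eq)
  then show ?thesis by (simp only: c_def w_def \<omega>_def)
qed

subsection \<open>The layer cake formula for the nonlocal curvature\<close>

definition tail_weight :: "real \<Rightarrow> real \<Rightarrow> real \<Rightarrow> real"
  where "tail_weight p a u = p * u powr (- p - 1) * indicator {a..} u"

lemma tail_weight_nonneg: "0 \<le> p \<Longrightarrow> 0 \<le> tail_weight p a u"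
  by (simp add: tail_weight_def)

lemma borel_measurable_tail_weight [measurable]: "tail_weight p a \<in> borel_measurable borel"
  unfolding tail_weight_def[abs_def] by measurable

lemma tail_weight_mult_indicator:
  "tail_weight p a u * indicator {t..} u = tail_weight p (max a t) u"
  by (simp add: tail_weight_def indicator_def)

lemma tail_weight_mult_power:
  assumes "a > 0" "s > 0"
  shows "tail_weight (real k + s) a u * u ^ k = (real k + s) / s * tail_weight s a u"
proof (cases "a \<le> u")
  case True
  then have "u powr (- (real k + s) - 1) * u ^ k = u powr (- s - 1)"
    using assms(1) by (simp add: powr_realpow[symmetric] powr_add[symmetric])
  then show ?thesis using assms(2) by (simp add: tail_weight_def indicator_def mult.assoc)
qed (simp add: tail_weight_def)

lemma has_bochner_integral_tail_weight:
  assumes "a > 0" "p > 0"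
  shows "has_bochner_integral lborel (tail_weight p a) (a powr (- p))"
proof (rule has_bochner_integral_nn_integral)
  have "(\<integral>\<^sup>+u. ennreal (p * u powr (- p - 1)) * indicator {a..} u \<partial>lborel) = 0 - (- (a powr (- p)))"
  proof (rule nn_integral_FTC_atLeast)
    show "DERIV (\<lambda>u. - (u powr (- p))) u :> p * u powr (- p - 1)" if "a \<le> u" for u
      using that assms by (auto intro!: derivative_eq_intros)
    show "((\<lambda>u. - (u powr (- p))) \<longlongrightarrow> 0) at_top"
      using tendsto_minus[OF tendsto_neg_powr[of "- p", OF _ filterlim_ident]] assms(2) by simp
  qed (use assms in auto)
  then show "(\<integral>\<^sup>+u. ennreal (tail_weight p a u) \<partial>lborel) = ennreal (a powr (- p))"
    by (simp add: tail_weight_def ennreal_mult'' ennreal_indicator)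
qed (use assms in \<open>auto simp: tail_weight_nonneg\<close>)

lemma has_bochner_integral_tail_weight_power:
  assumes "a > 0" "s > 0"
  shows "has_bochner_integral lborel
    (\<lambda>u. tail_weight (real k + s) a u * (u ^ k * indicator {\<delta>..} u))
    ((real k + s) / s * max a \<delta> powr (- s))"
proof -
  have "tail_weight (real k + s) a u * (u ^ k * indicator {\<delta>..} u)
      = (real k + s) / s * tail_weight s (max a \<delta>) u" for u
    using tail_weight_mult_power[OF assms, of k u]
    by (simp add: mult.assoc[symmetric] tail_weight_mult_indicator[symmetric])
  moreover have "has_bochner_integral lborel (\<lambda>u. (real k + s) / s * tail_weight s (max a \<delta>) u)
      ((real k + s) / s * max a \<delta> powr (- s))"
    using assms by (intro has_bochner_integral_mult_right has_bochner_integral_tail_weight) auto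
  ultimately show ?thesis by (simp only:)
qed

lemma kern_eq_max: "kern d s r t = max r t powr (- (real d + s))"
  by (simp add: kern_def max_def)

lemma integrable_layers:
  fixes x :: "'a::euclidean_space"
  assumes [measurable]: "S \<in> sets borel" and r: "0 < r" and s: "0 < s"
  shows "integrable (lborel \<Otimes>\<^sub>M lborel)
    (\<lambda>(u, y). tail_weight (real DIM('a) + s) r u * (side S y * indicator {norm (x - y)..} u))"
    (is "integrable _ (case_prod ?f)")
proof (rule lborel_pair.Fubini_integrable)
  define p where "p = real DIM('a) + s"
  have p: "p > 0" using s by (simp add: p_def add_nonneg_pos)
  have ball: "indicator {norm (x - y)..} u = (indicator (cball x u) y :: real)" for u y
    by (simp add: indicator_def dist_norm)
  show "case_prod ?f \<in> borel_measurable (lborel \<Otimes>\<^sub>M lborel)"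
    unfolding atLeast_def by measurable
  have "(\<integral>y. norm (?f u y) \<partial>lborel)
      = p * unit_ball_vol (real DIM('a)) / s * tail_weight s r u" for u
  proof (cases "r \<le> u")
    case True
    have "(\<integral>y. norm (?f u y) \<partial>lborel) = (\<integral>y. tail_weight p r u * indicator (cball x u) y \<partial>lborel)"
      using p
      by (intro Bochner_Integration.integral_cong)
        (auto simp: p_def abs_mult tail_weight_nonneg ball)
    also have "\<dots> = unit_ball_vol (real DIM('a)) * (tail_weight p r u * u ^ DIM('a))"
      using True r by (simp add: content_cball)
    finally show ?thesis by (simp add: tail_weight_mult_power[OF r s, folded p_def] p_def)
  qed (simp add: tail_weight_def)
  then show "integrable lborel (\<lambda>u. \<integral>y. norm (case (u, y) of (u, y) \<Rightarrow> ?f u y) \<partial>lborel)"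
    using has_bochner_integral_tail_weight[OF r s] by (simp add: has_bochner_integral_iff)
  show "AE u in lborel. integrable lborel (\<lambda>y. case (u, y) of (u, y) \<Rightarrow> ?f u y)"
    by (simp add: ball integrable_side_cball)
qed

lemma Kcurv_layer_cake:
  fixes x :: "'a::euclidean_space"
  assumes S: "S \<in> sets borel" and r: "0 < r" and s: "0 < s"
  shows "has_bochner_integral lborel (\<lambda>u. tail_weight (real DIM('a) + s) r u * imbalance x S u)
    (Kcurv s r x S)"
proof -
  define p where "p = real DIM('a) + s"
  define f where "f u y = tail_weight p r u * (side S y * indicator {norm (x - y)..} u)" for u y
  have p: "p > 0" using s by (simp add: p_def add_nonneg_pos)
  have int_f: "integrable (lborel \<Otimes>\<^sub>M lborel) (case_prod f)"
    unfolding f_def p_def by (rule integrable_layers[OF S r s])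
  have balls: "(\<integral>y. f u y \<partial>lborel) = tail_weight p r u * imbalance x S u" for u
    by (simp add: f_def imbalance_def indicator_def dist_norm)
  have "(\<integral>u. f u y \<partial>lborel) = side S y * kern DIM('a) s r (norm (x - y))" for y
  proof -
    have "f u y = side S y * tail_weight p (max r (norm (x - y))) u" for u
      by (simp add: f_def tail_weight_mult_indicator[symmetric])
    then show ?thesis
      using has_bochner_integral_tail_weight[of "max r (norm (x - y))" p] r p
      by (simp add: has_bochner_integral_iff kern_eq_max p_def less_max_iff_disj)
  qed
  then have "Kcurv s r x S = (\<integral>y. (\<integral>u. f u y \<partial>lborel) \<partial>lborel)"
    by (simp add: Kcurv_def side_def)
  also have "\<dots> = (\<integral>u. (\<integral>y. f u y \<partial>lborel) \<partial>lborel)"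
    by (rule lborel_pair.Fubini_integral[OF int_f])
  finally show ?thesis
    using lborel_pair.integrable_fst'[OF int_f] by (simp add: has_bochner_integral_iff balls p_def)
qed

lemma beta_integral:
  fixes r s :: real
  assumes r: "0 < r" "r < 1" and s: "1 < s"
  shows "has_bochner_integral lborel
    (\<lambda>u. tail_weight (real d + s) r u * (u ^ (d + 1) * indicator {..1} u))
    ((real d + 1) * beta d r s - 1)"
proof -
  define p where "p = real d + s"
  have "has_bochner_integral lborel (\<lambda>u. p * u powr (- s) * indicator {r..1} u)
      (p * 1 powr (1 - s) / (1 - s) - p * r powr (1 - s) / (1 - s))"
  proof (rule has_bochner_integral_FTC_Icc_nonneg)
    show "DERIV (\<lambda>u. p * u powr (1 - s) / (1 - s)) u :> p * u powr (- s)" if "u \<in> {r..1}" for u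
      using that r s by (auto intro!: derivative_eq_intros)
  qed (use r s in \<open>auto simp: p_def\<close>)
  also have "p * 1 powr (1 - s) / (1 - s) - p * r powr (1 - s) / (1 - s)
      = p * (r powr (1 - s) - 1) / (s - 1)"
    using s by (simp add: divide_simps) (simp add: algebra_simps)
  also have "\<dots> = (real d + 1) * beta d r s - 1"
  proof -
    have "p * t / v = q * (p / q * (t / v) + 1 / q) - 1" if "q \<noteq> 0" for q t v :: real
      using that by (simp add: distrib_left)
    then show ?thesis by (simp add: beta_def p_def add_nonneg_eq_0_iff)
  qed
  also have "(\<lambda>u. p * u powr (- s) * indicator {r..1} u)
      = (\<lambda>u. tail_weight p r u * (u ^ (d + 1) * indicator {..1} u))"
  proof
    fix u
    have "u powr (- s) = u powr (- p - 1) * u ^ (d + 1)" if "r \<le> u"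
      using that r
      by (simp add: p_def powr_realpow[symmetric] powr_add[symmetric] del: power_Suc power_add)
    then show "p * u powr (- s) * indicator {r..1} u
        = tail_weight p r u * (u ^ (d + 1) * indicator {..1} u)"
      by (simp add: tail_weight_def indicator_def)
  qed
  finally show ?thesis unfolding p_def .
qed

lemma abs_imbalance_diff_le:
  fixes x :: "'a::euclidean_space"
  assumes S: "S \<in> sets borel" and \<delta>: "\<delta> \<le> 1" and \<epsilon>: "0 \<le> \<epsilon>" and u: "0 < u"
    and near: "u \<le> \<delta> \<Longrightarrow> \<bar>imbalance x S u - c * u ^ (DIM('a) + 1)\<bar> \<le> \<epsilon> * u ^ (DIM('a) + 1)"
  defines "w \<equiv> u ^ (DIM('a) + 1) * indicator {..1} u"
  shows "\<bar>imbalance x S u - c * w\<bar>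
    \<le> \<epsilon> * w + (unit_ball_vol (real DIM('a)) + \<bar>c\<bar>) * (u ^ DIM('a) * indicator {\<delta>..} u)"
proof (cases "u \<le> \<delta>")
  case True
  have "0 \<le> (unit_ball_vol (real DIM('a)) + \<bar>c\<bar>) * (u ^ DIM('a) * indicator {\<delta>..} u)"
    using u by simp
  moreover have "w = u ^ (DIM('a) + 1)" using True \<delta> by (simp add: w_def)
  ultimately show ?thesis using near[OF True] by simp
next
  case False
  have "0 \<le> w" "w \<le> u ^ DIM('a)"
    using u by (auto simp: w_def indicator_def mult_left_le_one_le)
  then have "\<bar>c * w\<bar> \<le> \<bar>c\<bar> * u ^ DIM('a)" "0 \<le> \<epsilon> * w"
    using \<epsilon> by (simp_all add: abs_mult mult_left_mono)
  moreover have "\<bar>imbalance x S u\<bar> \<le> unit_ball_vol (real DIM('a)) * u ^ DIM('a)"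
    using S u by (intro abs_imbalance_le) auto
  ultimately show ?thesis using False by (simp add: distrib_right)
qed

lemma Kcurv_estimate:
  fixes x :: "'a::euclidean_space"
  assumes S: "S \<in> sets borel" and r: "0 < r" "r < 1" and s: "1 < s" and \<delta>: "0 < \<delta>" "\<delta> \<le> 1"
    and \<epsilon>: "0 \<le> \<epsilon>"
    and near: "\<And>u. 0 < u \<Longrightarrow> u \<le> \<delta> \<Longrightarrow> \<bar>imbalance x S u - c * u ^ (DIM('a) + 1)\<bar>
        \<le> \<epsilon> * u ^ (DIM('a) + 1)"
  defines "J \<equiv> (real DIM('a) + 1) * beta DIM('a) r s - 1"
  shows "\<bar>Kcurv s r x S - c * J\<bar>
     \<le> \<epsilon> * J + (unit_ball_vol (real DIM('a)) + \<bar>c\<bar>) * ((real DIM('a) + s) / s * \<delta> powr (- s))"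
proof -
  define p where "p = real DIM('a) + s"
  define C where "C = unit_ball_vol (real DIM('a)) + \<bar>c\<bar>"
  let ?k = "tail_weight p r"
  let ?j = "\<lambda>u. u ^ (DIM('a) + 1) * indicator {..1} u :: real"
  let ?t = "\<lambda>u. u ^ DIM('a) * indicator {\<delta>..} u :: real"
  have p: "0 \<le> p" using s by (simp add: p_def)
  have layers: "has_bochner_integral lborel (\<lambda>u. ?k u * imbalance x S u) (Kcurv s r x S)"
    unfolding p_def using S r(1) s by (intro Kcurv_layer_cake) auto
  have main: "has_bochner_integral lborel (\<lambda>u. ?k u * ?j u) J"
    unfolding J_def p_def using r s by (rule beta_integral)
  have tail: "has_bochner_integral lborel (\<lambda>u. ?k u * ?t u) (p / s * max r \<delta> powr (- s))"
    unfolding p_def using r s by (intro has_bochner_integral_tail_weight_power) auto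
  have "has_bochner_integral lborel (\<lambda>u. ?k u * imbalance x S u - c * (?k u * ?j u))
      (Kcurv s r x S - c * J)"
    by (intro has_bochner_integral_diff has_bochner_integral_mult_right layers main)
  moreover have "has_bochner_integral lborel (\<lambda>u. \<epsilon> * (?k u * ?j u) + C * (?k u * ?t u))
      (\<epsilon> * J + C * (p / s * max r \<delta> powr (- s)))"
    by (intro has_bochner_integral_add has_bochner_integral_mult_right main tail)
  moreover have "\<bar>?k u * imbalance x S u - c * (?k u * ?j u)\<bar>
      \<le> \<epsilon> * (?k u * ?j u) + C * (?k u * ?t u)" for u
  proof (cases "r \<le> u")
    case True
    then have "\<bar>imbalance x S u - c * ?j u\<bar> \<le> \<epsilon> * ?j u + C * ?t u"
      unfolding C_def using S \<delta> \<epsilon> r near by (intro abs_imbalance_diff_le) auto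
    then have "?k u * \<bar>imbalance x S u - c * ?j u\<bar> \<le> ?k u * (\<epsilon> * ?j u + C * ?t u)"
      using p by (intro mult_left_mono tail_weight_nonneg)
    moreover have "\<bar>?k u * imbalance x S u - c * (?k u * ?j u)\<bar>
        = ?k u * \<bar>imbalance x S u - c * ?j u\<bar>"
      using tail_weight_nonneg[OF p, of r u] abs_mult[of "?k u" "imbalance x S u - c * ?j u"]
      by (simp add: right_diff_distrib mult.left_commute)
    ultimately show ?thesis by (simp add: distrib_left mult.left_commute)
  qed (simp add: tail_weight_def)
  ultimately have "\<bar>Kcurv s r x S - c * J\<bar> \<le> \<epsilon> * J + C * (p / s * max r \<delta> powr (- s))"
    unfolding has_bochner_integral_iff by (metis (no_types, lifting) integral_abs_bound_integral)
  also have "\<dots> \<le> \<epsilon> * J + C * (p / s * \<delta> powr (- s))"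
    using p s \<delta> by (intro add_left_mono mult_left_mono powr_mono2') (auto simp: C_def)
  finally show ?thesis by (simp add: C_def p_def)
qed

lemma beta_at_top:
  assumes r: "\<And>n. 0 < r n \<and> r n < 1" and s: "\<And>n. 1 < s n" and r0: "(r \<longlongrightarrow> 0) F"
  shows "filterlim (\<lambda>n. beta d (r n) (s n)) at_top F"
proof (rule filterlim_at_top_mono)
  have "filterlim r (at_right 0) F"
    using r0 r less_imp_neq[of 0] by (auto simp: filterlim_at intro!: always_eventually)
  then have "filterlim (\<lambda>n. ln (r n)) at_bot F" by (rule filterlim_compose[OF ln_at_0])
  then show "filterlim (\<lambda>n. - ln (r n)) at_top F" by (simp add: filterlim_uminus_at_bot)
  show "\<forall>\<^sub>F n in F. - ln (r n) \<le> beta d (r n) (s n)"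
  proof (intro always_eventually allI)
    fix n
    define t where "t = (r n powr (1 - s n) - 1) / (s n - 1)"
    have "1 + (s n - 1) * (- ln (r n)) \<le> exp ((s n - 1) * (- ln (r n)))"
      by (rule exp_ge_add_one_self)
    also have "\<dots> = r n powr (1 - s n)" using r[of n] by (simp add: powr_def algebra_simps)
    finally have t: "- ln (r n) \<le> t" using s[of n] by (simp add: t_def field_simps)
    also have "0 \<le> - ln (r n)" using r[of n] by simp
    then have "1 * t \<le> (real d + s n) / (real d + 1) * t"
      using s[of n] t by (intro mult_right_mono) (auto simp: field_simps)
    then have "t \<le> beta d (r n) (s n)" by (simp add: beta_def t_def[symmetric] add_increasing2)
    finally show "- ln (r n) \<le> beta d (r n) (s n)" .
  qed
qed

lemma tendsto_divide_of_almost_multiple: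
  fixes K J :: "'b \<Rightarrow> real"
  assumes J: "filterlim J at_top F"
    and almost: "\<And>\<epsilon>. \<epsilon> > 0 \<Longrightarrow> \<exists>C. \<forall>\<^sub>F n in F. \<bar>K n - c * J n\<bar> \<le> \<epsilon> * J n + C"
  shows "((\<lambda>n. K n / J n) \<longlongrightarrow> c) F"
proof (rule tendstoI)
  fix e :: real assume e: "e > 0"
  then obtain C where C: "\<forall>\<^sub>F n in F. \<bar>K n - c * J n\<bar> \<le> e / 2 * J n + C"
    using almost[of "e / 2"] by auto
  have "\<forall>\<^sub>F n in F. J n > max 0 (2 * C / e)"
    using J unfolding filterlim_at_top_dense by blast
  with C show "\<forall>\<^sub>F n in F. dist (K n / J n) c < e"
  proof eventually_elim
    case (elim n)
    then have "C < e / 2 * J n" using e by (simp add: field_simps)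
    then have "\<bar>K n - c * J n\<bar> < e * J n" using elim by linarith
    moreover have "K n / J n - c = (K n - c * J n) / J n" using elim by (simp add: field_simps)
    ultimately show ?case using elim by (simp add: dist_real_def abs_divide pos_divide_less_eq)
  qed
qed

lemma eventually_prod_at_right_0E:
  assumes "\<forall>\<^sub>F p in F \<times>\<^sub>F at_right (0::real). case p of (n, u) \<Rightarrow> P n u"
  obtains \<delta> where "0 < \<delta>" "\<forall>\<^sub>F n in F. \<forall>u. 0 < u \<longrightarrow> u \<le> \<delta> \<longrightarrow> P n u"
proof -
  obtain Pf Pg where Pf: "eventually Pf F" and Pg: "eventually Pg (at_right (0::real))"
    and P: "\<And>n u. Pf n \<Longrightarrow> Pg u \<Longrightarrow> P n u"
    using assms unfolding eventually_prod_filter by auto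
  obtain b where "b > 0" "\<And>u. 0 < u \<Longrightarrow> u < b \<Longrightarrow> Pg u"
    using Pg unfolding eventually_at_right_field by blast
  with Pf P show thesis
    by (intro that[of "b / 2"]) (auto elim!: eventually_mono)
qed

lemma tendsto_ratio_prod_at_right_0E:
  fixes V :: "'b \<Rightarrow> real \<Rightarrow> real"
  assumes "((\<lambda>(n, u). V n u / u ^ k) \<longlongrightarrow> c) (F \<times>\<^sub>F at_right 0)" "\<epsilon> > 0"
  obtains \<delta> where "0 < \<delta>" "\<delta> \<le> 1" "\<forall>\<^sub>F n in F. \<forall>u. 0 < u \<longrightarrow> u \<le> \<delta> \<longrightarrow> \<bar>V n u - c * u ^ k\<bar> \<le> \<epsilon> * u ^ k"
proof -
  have "\<forall>\<^sub>F p in F \<times>\<^sub>F at_right 0. case p of (n, u) \<Rightarrow> \<bar>V n u / u ^ k - c\<bar> < \<epsilon>"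
    using tendstoD[OF assms] by (simp add: dist_real_def case_prod_beta')
  then obtain \<delta> where "0 < \<delta>"
    and near: "\<forall>\<^sub>F n in F. \<forall>u. 0 < u \<longrightarrow> u \<le> \<delta> \<longrightarrow> \<bar>V n u / u ^ k - c\<bar> < \<epsilon>"
    by (rule eventually_prod_at_right_0E)
  have "\<bar>v - c * t\<bar> \<le> \<epsilon> * t" if "\<bar>v / t - c\<bar> < \<epsilon>" "0 < t" for v t :: real
  proof -
    have "v - c * t = (v / t - c) * t" using that(2) by (simp add: left_diff_distrib)
    then have "\<bar>v - c * t\<bar> = \<bar>v / t - c\<bar> * t" using that(2) by (simp only: abs_mult abs_of_pos)
    then show ?thesis using that by (simp add: mult_right_mono)
  qed
  then show thesis
    using \<open>0 < \<delta>\<close> near by (intro that[of "min 1 \<delta>"]) (auto elim!: eventually_mono)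
qed

lemma Kcurv_asymptotics:
  fixes x :: "'a::euclidean_space" and S :: "'b \<Rightarrow> 'a set"
  assumes S: "\<And>n. S n \<in> sets borel"
    and r: "\<And>n. 0 < r n \<and> r n < 1" "(r \<longlongrightarrow> 0) F" and s: "\<And>n. 1 < s n" "(s \<longlongrightarrow> 1) F"
    and expansion: "((\<lambda>(n, u). imbalance x (S n) u / u ^ (DIM('a) + 1)) \<longlongrightarrow> c) (F \<times>\<^sub>F at_right 0)"
  shows "((\<lambda>n. Kcurv (s n) (r n) x (S n) / beta DIM('a) (r n) (s n)) \<longlongrightarrow> c * (real DIM('a) + 1)) F"
proof (rule tendsto_divide_of_almost_multiple)
  let ?d = "real DIM('a)" and ?beta = "\<lambda>n. beta DIM('a) (r n) (s n)"
  show "filterlim ?beta at_top F" using r s(1) by (intro beta_at_top)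
  fix \<epsilon> :: real assume "\<epsilon> > 0"
  then have \<epsilon>: "\<epsilon> / (?d + 1) > 0" by (simp add: add_nonneg_pos)
  obtain \<delta> where \<delta>: "0 < \<delta>" "\<delta> \<le> 1" and near: "\<forall>\<^sub>F n in F. \<forall>u. 0 < u \<longrightarrow> u \<le> \<delta> \<longrightarrow>
      \<bar>imbalance x (S n) u - c * u ^ (DIM('a) + 1)\<bar> \<le> \<epsilon> / (?d + 1) * u ^ (DIM('a) + 1)"
    using tendsto_ratio_prod_at_right_0E[OF expansion \<epsilon>] .
  define C where "C t = (unit_ball_vol ?d + \<bar>c\<bar>) * ((?d + t) / t * \<delta> powr (- t))" for t
  have "((\<lambda>n. C (s n)) \<longlongrightarrow> C 1) F"
    unfolding C_def using \<delta>(1) s by (intro tendsto_intros) auto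
  then have "\<forall>\<^sub>F n in F. C (s n) < C 1 + 1" by (rule order_tendstoD) simp
  with near have "\<forall>\<^sub>F n in F. \<bar>Kcurv (s n) (r n) x (S n) - c * (?d + 1) * ?beta n\<bar>
      \<le> \<epsilon> * ?beta n + (C 1 + 1 + \<bar>c\<bar>)"
  proof eventually_elim
    case (elim n)
    define J where "J = (?d + 1) * ?beta n - 1"
    have "\<bar>Kcurv (s n) (r n) x (S n) - c * J\<bar> \<le> \<epsilon> / (?d + 1) * J + C (s n)"
      unfolding J_def C_def using S r s \<delta> \<epsilon> elim(1) by (intro Kcurv_estimate) auto
    moreover have "\<epsilon> / (?d + 1) * J \<le> \<epsilon> / (?d + 1) * ((?d + 1) * ?beta n)"
      using \<epsilon> by (intro mult_left_mono) (auto simp: J_def)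
    moreover have "\<epsilon> / (?d + 1) * ((?d + 1) * ?beta n) = \<epsilon> * ?beta n"
      by (simp add: add_nonneg_eq_0_iff)
    moreover have "c * J = c * (?d + 1) * ?beta n - c"
      by (simp add: J_def right_diff_distrib mult.assoc)
    ultimately show ?case using elim(2) by linarith
  qed
  then show "\<exists>C. \<forall>\<^sub>F n in F. \<bar>Kcurv (s n) (r n) x (S n) - c * (?d + 1) * ?beta n\<bar> \<le> \<epsilon> * ?beta n + C"
    by blast
qed

subsection \<open>Uniform quadratic expansion of the moving boundaries\<close>

lemma norm_diff_linear_le:
  fixes f :: "'a::real_normed_vector \<Rightarrow> 'b::real_normed_vector" and T :: "'a \<Rightarrow>\<^sub>L 'b"
  assumes "convex U" "a \<in> U" "y \<in> U"
    and f: "\<And>z. z \<in> U \<Longrightarrow> (f has_derivative blinfun_apply (Df z)) (at z)"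
    and close: "\<And>z. z \<in> U \<Longrightarrow> norm (Df z - T) \<le> \<eta>"
  shows "norm (f y - f a - T (y - a)) \<le> \<eta> * norm (y - a)"
proof -
  have "norm ((f y - T y) - (f a - T a)) \<le> \<eta> * norm (y - a)"
  proof (rule differentiable_bound[OF assms(1) _ _ assms(3,2),
        of "\<lambda>z. f z - T z" "\<lambda>z. blinfun_apply (Df z - T)"])
    fix z assume z: "z \<in> U"
    have "((\<lambda>z. f z - T z) has_derivative (\<lambda>h. Df z h - T h)) (at z)"
      by (intro derivative_intros f z blinfun.bounded_linear_right
          bounded_linear_imp_has_derivative)
    then show "((\<lambda>z. f z - T z) has_derivative blinfun_apply (Df z - T)) (at z within U)"
      by (simp add: blinfun.diff_left[abs_def] has_derivative_at_withinI)
    show "onorm (blinfun_apply (Df z - T)) \<le> \<eta>"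
      using close[OF z] by (simp add: norm_blinfun.rep_eq)
  qed
  then show ?thesis by (simp add: blinfun.diff_right algebra_simps)
qed

text \<open>
  Differentiating along the segment makes the symmetry of the second derivative unnecessary.
\<close>

lemma norm_taylor2_le:
  fixes f :: "'a::real_normed_vector \<Rightarrow> 'b::real_normed_vector" and Q :: "'a \<Rightarrow>\<^sub>L 'a \<Rightarrow>\<^sub>L 'b"
  assumes U: "convex U" "a \<in> U" "a + v \<in> U"
    and f: "\<And>z. z \<in> U \<Longrightarrow> (f has_derivative blinfun_apply (Df z)) (at z)"
    and Df: "\<And>z. z \<in> U \<Longrightarrow> (Df has_derivative blinfun_apply (D2f z)) (at z)"
    and close: "\<And>z. z \<in> U \<Longrightarrow> norm (D2f z - Q) \<le> \<eta>"
  shows "norm (f (a + v) - f a - Df a v - (1/2) *\<^sub>R Q v v) \<le> \<eta> * (norm v)\<^sup>2"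
proof -
  define g where "g t = f (a + t *\<^sub>R v) - t *\<^sub>R Df a v - (t\<^sup>2 / 2) *\<^sub>R Q v v" for t :: real
  define g' where "g' t = (Df (a + t *\<^sub>R v) - Df a - Q (t *\<^sub>R v)) v" for t :: real
  have seg: "a + t *\<^sub>R v \<in> U" if "t \<in> {0..1}" for t
    using convexD[OF U, of "1 - t" t] that by (simp add: algebra_simps)
  have \<eta>: "0 \<le> \<eta>" using order_trans[OF norm_ge_zero close[OF U(2)]] .
  have "norm (g 1 - g 0) \<le> \<eta> * (norm v)\<^sup>2 * norm (1 - 0 :: real)"
  proof (rule differentiable_bound[of "{0..1}" g "\<lambda>t h. h *\<^sub>R g' t"])
    fix t :: real assume t: "t \<in> {0..1}"
    have "((\<lambda>t. f (a + t *\<^sub>R v)) has_derivative (\<lambda>h. Df (a + t *\<^sub>R v) (h *\<^sub>R v))) (at t)"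
      by (rule has_derivative_compose[of "\<lambda>t. a + t *\<^sub>R v", OF _ f[OF seg[OF t]]])
        (auto intro!: derivative_eq_intros)
    moreover have "((\<lambda>t. t *\<^sub>R Df a v) has_derivative (\<lambda>h. h *\<^sub>R Df a v)) (at t)"
      "((\<lambda>t. (t\<^sup>2 / 2) *\<^sub>R Q v v) has_derivative (\<lambda>h. (h * t) *\<^sub>R Q v v)) (at t)"
      by (auto intro!: derivative_eq_intros)
    ultimately have "(g has_derivative
        (\<lambda>h. Df (a + t *\<^sub>R v) (h *\<^sub>R v) - h *\<^sub>R Df a v - (h * t) *\<^sub>R Q v v)) (at t)"
      unfolding g_def by (intro has_derivative_diff)
    moreover have "Df (a + t *\<^sub>R v) (h *\<^sub>R v) - h *\<^sub>R Df a v - (h * t) *\<^sub>R Q v v = h *\<^sub>R g' t" for h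
      by (simp add: g'_def blinfun.add_left blinfun.diff_left blinfun.scaleR_left
          blinfun.scaleR_right algebra_simps)
    ultimately show "(g has_derivative (\<lambda>h. h *\<^sub>R g' t)) (at t within {0..1})"
      by (simp add: has_derivative_at_withinI)
    have "norm (g' t) \<le> norm (Df (a + t *\<^sub>R v) - Df a - Q (t *\<^sub>R v)) * norm v"
      unfolding g'_def by (rule norm_blinfun)
    also have "\<dots> \<le> \<eta> * norm (t *\<^sub>R v) * norm v"
      using norm_diff_linear_le[OF U(1,2) seg[OF t] Df close] by (intro mult_right_mono) auto
    also have "\<dots> = t * (\<eta> * (norm v)\<^sup>2)" using t by (simp add: power2_eq_square)
    also have "\<dots> \<le> \<eta> * (norm v)\<^sup>2" using t \<eta> by (intro mult_left_le_one_le) auto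
    finally show "onorm (\<lambda>h. h *\<^sub>R g' t) \<le> \<eta> * (norm v)\<^sup>2"
      by (intro onorm_le) (simp add: mult.commute mult_left_mono)
  qed auto
  then show ?thesis by (simp add: g_def algebra_simps)
qed

lemma local_defining_taylor:
  fixes \<phi> :: "'a::euclidean_space \<Rightarrow> real"
  assumes "local_defining E x \<rho> \<phi> D\<phi> D2\<phi>" "\<eta> > 0"
  obtains \<rho>' where "0 < \<rho>'" "\<rho>' \<le> \<rho>"
    "\<And>a v. a \<in> ball x \<rho>' \<Longrightarrow> a + v \<in> ball x \<rho>' \<Longrightarrow>
       \<bar>\<phi> (a + v) - \<phi> a - D\<phi> a v - D2\<phi> x v v / 2\<bar> \<le> \<eta> * (norm v)\<^sup>2"
proof -
  have \<rho>: "\<rho> > 0" and cont: "continuous_on (ball x \<rho>) D2\<phi>"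
    and D: "\<And>y. y \<in> ball x \<rho> \<Longrightarrow> (\<phi> has_derivative blinfun_apply (D\<phi> y)) (at y)"
    and D2: "\<And>y. y \<in> ball x \<rho> \<Longrightarrow> (D\<phi> has_derivative blinfun_apply (D2\<phi> y)) (at y)"
    using assms(1) by (auto simp: local_defining_def)
  have "isCont D2\<phi> x" using cont \<rho> by (simp add: continuous_on_eq_continuous_at)
  then obtain e where e: "e > 0" "\<And>y. dist y x < e \<Longrightarrow> dist (D2\<phi> y) (D2\<phi> x) < \<eta>"
    unfolding continuous_at_eps_delta using \<open>\<eta> > 0\<close> by blast
  show thesis
  proof (rule that[of "min e \<rho>"])
    fix a v assume av: "a \<in> ball x (min e \<rho>)" "a + v \<in> ball x (min e \<rho>)"
    have "norm (\<phi> (a + v) - \<phi> a - D\<phi> a v - (1/2) *\<^sub>R D2\<phi> x v v) \<le> \<eta> * (norm v)\<^sup>2"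
      by (rule norm_taylor2_le[OF convex_ball av D D2])
        (use e(2) in \<open>auto simp: dist_norm[symmetric] dist_commute less_imp_le\<close>)
    then show "\<bar>\<phi> (a + v) - \<phi> a - D\<phi> a v - D2\<phi> x v v / 2\<bar> \<le> \<eta> * (norm v)\<^sup>2" by simp
  qed (use e \<rho> in auto)
qed

definition near_identity :: "real \<Rightarrow> ('a::euclidean_space \<Rightarrow> 'a) \<Rightarrow> bool"
  where "near_identity \<epsilon> \<Phi> \<longleftrightarrow>
    (\<exists>(D\<Phi> :: 'a \<Rightarrow> 'a \<Rightarrow>\<^sub>L 'a) (D2\<Phi> :: 'a \<Rightarrow> 'a \<Rightarrow>\<^sub>L 'a \<Rightarrow>\<^sub>L 'a). \<forall>y.
      (\<Phi> has_derivative blinfun_apply (D\<Phi> y)) (at y)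
      \<and> (D\<Phi> has_derivative blinfun_apply (D2\<Phi> y)) (at y)
      \<and> norm (\<Phi> y - y) \<le> \<epsilon> \<and> norm (D\<Phi> y - id_blinfun) \<le> \<epsilon> \<and> norm (D2\<Phi> y) \<le> \<epsilon>)"

lemma convCE:
  assumes "convC En E"
  obtains \<Phi> where "\<And>n. bij (\<Phi> n)" "\<And>n. En n = \<Phi> n ` E" "\<And>n. C2_on UNIV (inv (\<Phi> n))"
    "\<And>\<epsilon>. \<epsilon> > 0 \<Longrightarrow> \<forall>\<^sub>F n in sequentially. near_identity \<epsilon> (\<Phi> n)"
proof -
  from assms obtain \<Phi> :: "nat \<Rightarrow> 'a \<Rightarrow> 'a" and D\<Phi> :: "nat \<Rightarrow> 'a \<Rightarrow> 'a \<Rightarrow>\<^sub>L 'a"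
    and D2\<Phi> :: "nat \<Rightarrow> 'a \<Rightarrow> 'a \<Rightarrow>\<^sub>L 'a \<Rightarrow>\<^sub>L 'a"
    where diffeo: "\<forall>n. bij (\<Phi> n) \<and> C2_on UNIV (inv (\<Phi> n))
             \<and> (\<forall>y. (\<Phi> n has_derivative blinfun_apply (D\<Phi> n y)) (at y)
                  \<and> (D\<Phi> n has_derivative blinfun_apply (D2\<Phi> n y)) (at y))
             \<and> continuous_on UNIV (D2\<Phi> n) \<and> \<Phi> n ` E = En n"
      and close: "\<forall>\<epsilon>>0. \<forall>\<^sub>F n in sequentially. \<forall>y.
            norm (\<Phi> n y - y) \<le> \<epsilon> \<and> norm (D\<Phi> n y - id_blinfun) \<le> \<epsilon> \<and> norm (D2\<Phi> n y) \<le> \<epsilon>"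
    unfolding convC_def by (elim exE conjE)
  have "\<forall>\<^sub>F n in sequentially. near_identity \<epsilon> (\<Phi> n)" if "\<epsilon> > 0" for \<epsilon>
    using close[rule_format, OF that]
  proof eventually_elim
    case (elim n)
    then show ?case
      unfolding near_identity_def using diffeo by (intro exI[of _ "D\<Phi> n"] exI[of _ "D2\<Phi> n"]) simp
  qed
  then show thesis using diffeo by (intro that[of \<Phi>]) auto
qed

lemma norm_right_inverse_near_id:
  fixes A B :: "'a::real_normed_vector \<Rightarrow>\<^sub>L 'a"
  assumes inverse: "\<And>h. A (B h) = h" and A: "norm (A - id_blinfun) \<le> \<epsilon>" and \<epsilon>: "\<epsilon> \<le> 1/2"
  shows "norm (B h) \<le> 2 * norm h" and "norm (B - id_blinfun) \<le> 2 * \<epsilon>"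
proof -
  have \<epsilon>0: "0 \<le> \<epsilon>" using A norm_ge_zero order_trans by blast
  have close: "norm (B h - h) \<le> \<epsilon> * norm (B h)" for h
  proof -
    have "norm (B h - h) = norm ((A - id_blinfun) (B h))"
      by (simp add: blinfun.diff_left inverse norm_minus_commute)
    also have "\<dots> \<le> \<epsilon> * norm (B h)"
      using norm_blinfun mult_right_mono[OF A norm_ge_zero] by (rule order_trans)
    finally show ?thesis .
  qed
  show B_le: "norm (B h) \<le> 2 * norm h" for h
    using close[of h] norm_triangle_sub[of "B h" h] mult_right_mono[OF \<epsilon> norm_ge_zero[of "B h"]]
    by linarith
  show "norm (B - id_blinfun) \<le> 2 * \<epsilon>"
  proof (rule norm_blinfun_bound)
    fix h
    have "norm (B h - h) \<le> \<epsilon> * (2 * norm h)"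
      using close[of h] mult_left_mono[OF B_le[of h] \<epsilon>0] by linarith
    then show "norm ((B - id_blinfun) h) \<le> 2 * \<epsilon> * norm h" by (simp add: blinfun.diff_left)
  qed (use \<epsilon>0 in simp)
qed

lemma has_derivative_inv_of_bij:
  fixes \<Phi> :: "'a::real_normed_vector \<Rightarrow> 'a"
  assumes "bij \<Phi>" "(\<Phi> has_derivative A) (at (inv \<Phi> x))" "(inv \<Phi> has_derivative B) (at x)"
  shows "A (B h) = h" "B (A h) = h"
proof -
  have "\<Phi> \<circ> inv \<Phi> = id" "inv \<Phi> \<circ> \<Phi> = id" "\<Phi> (inv \<Phi> x) = x"
    using assms(1) by (auto simp: fun_eq_iff bij_is_inj bij_is_surj surj_f_inv_f)
  moreover have "(\<Phi> \<circ> inv \<Phi> has_derivative A \<circ> B) (at x)"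
    using assms(2,3) by (rule diff_chain_at[rotated])
  moreover have "(inv \<Phi> \<circ> \<Phi> has_derivative B \<circ> A) (at (inv \<Phi> x))"
    using assms(2,3) calculation(3) by (intro diff_chain_at) auto
  ultimately have "A \<circ> B = id" "B \<circ> A = id"
    using has_derivative_unique[OF _ has_derivative_id] by auto
  then show "A (B h) = h" "B (A h) = h" by (auto simp: fun_eq_iff)
qed

lemma near_identity_inverse:
  fixes \<Phi> :: "'a::euclidean_space \<Rightarrow> 'a"
  assumes bij: "bij \<Phi>" and \<Phi>: "near_identity \<epsilon> \<Phi>" and \<epsilon>: "\<epsilon> \<le> 1/2"
    and B: "(inv \<Phi> has_derivative blinfun_apply B) (at x)"
  defines "v \<equiv> \<lambda>z. inv \<Phi> (x + z) - inv \<Phi> x"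
  shows "norm (inv \<Phi> x - x) \<le> \<epsilon>"
    and "norm (B - id_blinfun) \<le> 2 * \<epsilon>"
    and "norm (v z) \<le> 2 * norm z"
    and "norm (v z - z) \<le> 2 * \<epsilon> * norm z"
    and "norm (v z - B z) \<le> 8 * \<epsilon> * (norm z)\<^sup>2"
proof -
  define a where "a = inv \<Phi> x"
  obtain D\<Phi> :: "'a \<Rightarrow> 'a \<Rightarrow>\<^sub>L 'a" and D2\<Phi> :: "'a \<Rightarrow> 'a \<Rightarrow>\<^sub>L 'a \<Rightarrow>\<^sub>L 'a" where
    D: "\<And>y. (\<Phi> has_derivative blinfun_apply (D\<Phi> y)) (at y)"
    and D2: "\<And>y. (D\<Phi> has_derivative blinfun_apply (D2\<Phi> y)) (at y)"
    and close: "\<And>y. norm (\<Phi> y - y) \<le> \<epsilon>" "\<And>y. norm (D\<Phi> y - id_blinfun) \<le> \<epsilon>" "\<And>y. norm (D2\<Phi> y) \<le> \<epsilon>"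
    using \<Phi> unfolding near_identity_def by blast
  have \<epsilon>0: "0 \<le> \<epsilon>" using close(1) norm_ge_zero order_trans by blast
  have \<Phi>a: "\<Phi> a = x" and \<Phi>v: "\<Phi> (a + v z) = x + z"
    using bij by (simp_all add: a_def v_def bij_is_surj surj_f_inv_f)
  note inverse = has_derivative_inv_of_bij[OF bij D[of "inv \<Phi> x"] B, folded a_def]
  note B_close = norm_right_inverse_near_id[OF inverse(1) close(2) \<epsilon>]
  show "norm (inv \<Phi> x - x) \<le> \<epsilon>"
    using close(1)[of a] by (simp add: \<Phi>a) (simp add: a_def norm_minus_commute)
  show "norm (B - id_blinfun) \<le> 2 * \<epsilon>" by (rule B_close)
  have vz: "norm (v z - z) \<le> \<epsilon> * norm (v z)"
    using norm_diff_linear_le[of UNIV a "a + v z" \<Phi> D\<Phi> id_blinfun \<epsilon>] D close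
    by (simp add: \<Phi>v \<Phi>a norm_minus_commute)
  show v_le: "norm (v z) \<le> 2 * norm z"
    using vz norm_triangle_sub[of "v z" z] mult_right_mono[OF \<epsilon> norm_ge_zero[of "v z"]] by simp
  show "norm (v z - z) \<le> 2 * \<epsilon> * norm z"
    using vz mult_left_mono[OF v_le \<epsilon>0] by simp
  have "norm (z - D\<Phi> a (v z)) \<le> \<epsilon> * (norm (v z))\<^sup>2"
    using norm_taylor2_le[of UNIV a "v z" \<Phi> D\<Phi> D2\<Phi> 0 \<epsilon>] D D2 close by (simp add: \<Phi>v \<Phi>a)
  also have "\<dots> \<le> \<epsilon> * (2 * norm z)\<^sup>2" using v_le \<epsilon>0 by (intro mult_left_mono power_mono) auto
  finally have "norm (z - D\<Phi> a (v z)) \<le> 4 * \<epsilon> * (norm z)\<^sup>2" by (simp add: power_mult_distrib)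
  moreover have "v z - B z = - B (z - D\<Phi> a (v z))" by (simp add: blinfun.diff_right inverse(2))
  ultimately show "norm (v z - B z) \<le> 8 * \<epsilon> * (norm z)\<^sup>2"
    using B_close(1)[of "z - D\<Phi> a (v z)"] by simp
qed

lemma local_defining_eq_0_frontier:
  assumes "local_defining E x \<rho> \<phi> D\<phi> D2\<phi>" "closed E" "a \<in> frontier E" "a \<in> ball x \<rho>"
  shows "\<phi> a = 0"
proof (rule antisym)
  have E: "y \<in> E \<longleftrightarrow> \<phi> y \<le> 0" if "y \<in> ball x \<rho>" for y
    using assms(1) that unfolding local_defining_def by blast
  show "\<phi> a \<le> 0" using E assms(2-4) frontier_subset_closed by blast
  show "0 \<le> \<phi> a"
  proof (rule ccontr)
    assume "\<not> 0 \<le> \<phi> a"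
    moreover have "isCont \<phi> a"
      using assms(1,4) unfolding local_defining_def by (meson has_derivative_continuous)
    then have "(\<phi> \<longlongrightarrow> \<phi> a) (nhds a)" by (simp add: isCont_def tendsto_at_iff_tendsto_nhds)
    ultimately have "\<forall>\<^sub>F y in nhds a. \<phi> y < 0" by (intro order_tendstoD(2)) auto
    moreover have "\<forall>\<^sub>F y in nhds a. y \<in> ball x \<rho>" using assms(4)
      by (intro eventually_nhds_in_open) auto
    ultimately have "\<forall>\<^sub>F y in nhds a. y \<in> E" by eventually_elim (simp add: E)
    then have "a \<in> interior E" by (auto simp: eventually_nhds interior_def)
    then show False using assms(3) by (simp add: frontier_def)
  qed
qed

lemma mem_bij_image_iff: "bij \<Phi> \<Longrightarrow> y \<in> \<Phi> ` E \<longleftrightarrow> inv \<Phi> y \<in> E"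
  by (metis bij_inv_eq_iff image_iff)

lemma inv_frontier_bij_image:
  assumes "bij \<Phi>" "continuous_on UNIV (inv \<Phi>)" "x \<in> frontier (\<Phi> ` E)"
  shows "inv \<Phi> x \<in> frontier E"
  using continuous_map_frontier_frontier_preimage_subset[of euclidean euclidean "inv \<Phi>" E] assms
  by (auto simp flip: mem_bij_image_iff[OF assms(1)])

lemma abs_quadratic_expansion_le:
  fixes L :: "'a::real_normed_vector \<Rightarrow>\<^sub>L real" and Q :: "'a \<Rightarrow>\<^sub>L 'a \<Rightarrow>\<^sub>L real"
  assumes v: "norm v \<le> 2 * norm z" "norm (v - z) \<le> 2 * \<epsilon> * norm z"
      "norm (v - w) \<le> 8 * \<epsilon> * (norm z)\<^sup>2"
    and L: "norm L \<le> M" and \<epsilon>: "0 \<le> \<epsilon>"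
  shows "\<bar>(L v + Q v v / 2) - (L w + Q z z / 2)\<bar> \<le> (8 * M + 3 * norm Q) * \<epsilon> * (norm z)\<^sup>2"
proof -
  have M: "0 \<le> M" using L norm_ge_zero order_trans by blast
  have linear: "\<bar>L v - L w\<bar> \<le> 8 * M * \<epsilon> * (norm z)\<^sup>2"
  proof -
    have "\<bar>L v - L w\<bar> = norm (L (v - w))" by (simp add: blinfun.diff_right)
    also have "\<dots> \<le> norm L * norm (v - w)" by (rule norm_blinfun)
    also have "\<dots> \<le> M * (8 * \<epsilon> * (norm z)\<^sup>2)" using L v M by (intro mult_mono) auto
    finally show ?thesis by (simp add: mult_ac)
  qed
  have quadratic: "\<bar>Q v v - Q z z\<bar> \<le> 6 * norm Q * \<epsilon> * (norm z)\<^sup>2"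
  proof -
    have "Q v v - Q z z = Q (v - z) v + Q z (v - z)"
      by (simp add: blinfun.diff_right blinfun.diff_left)
    also have "\<bar>\<dots>\<bar> \<le> norm Q * norm (v - z) * norm v + norm Q * norm z * norm (v - z)"
      using abs_blinfun2_le[of Q "v - z" v] abs_blinfun2_le[of Q z "v - z"] by linarith
    also have "\<dots> = norm Q * norm (v - z) * (norm v + norm z)" by (simp add: algebra_simps)
    also have "\<dots> \<le> norm Q * (2 * \<epsilon> * norm z) * (3 * norm z)"
      using v \<epsilon> by (intro mult_mono) auto
    finally show ?thesis by (simp add: power2_eq_square mult_ac)
  qed
  have "(8 * M + 3 * norm Q) * \<epsilon> * (norm z)\<^sup>2
      = 8 * M * \<epsilon> * (norm z)\<^sup>2 + 6 * norm Q * \<epsilon> * (norm z)\<^sup>2 / 2"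
    by (simp add: algebra_simps)
  then show ?thesis using linear quadratic by linarith
qed

lemma quadric_approx_near_identity_image:
  fixes x :: "'a::euclidean_space" and D\<phi> :: "'a \<Rightarrow> 'a \<Rightarrow>\<^sub>L real" and Q :: "'a \<Rightarrow>\<^sub>L 'a \<Rightarrow>\<^sub>L real"
  assumes E: "E \<inter> ball x \<rho> = {y \<in> ball x \<rho>. \<phi> y \<le> 0}"
    and taylor: "\<And>a v. a \<in> ball x \<rho> \<Longrightarrow> a + v \<in> ball x \<rho> \<Longrightarrow>
       \<bar>\<phi> (a + v) - \<phi> a - D\<phi> a v - Q v v / 2\<bar> \<le> \<eta> / 8 * (norm v)\<^sup>2"
    and \<Phi>: "bij \<Phi>" "near_identity \<epsilon> \<Phi>" and B: "(inv \<Phi> has_derivative blinfun_apply B) (at x)"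
    and zero: "\<phi> (inv \<Phi> x) = 0" and L: "norm (D\<phi> (inv \<Phi> x)) \<le> M"
    and \<epsilon>: "\<epsilon> \<le> 1/2" "\<epsilon> < \<rho> / 2" "(8 * M + 3 * norm Q) * \<epsilon> \<le> \<eta> / 2" and \<eta>: "0 \<le> \<eta>"
  shows "quadric_approx (\<Phi> ` E) x (\<rho> / 8) \<eta> (D\<phi> (inv \<Phi> x) o\<^sub>L B) Q"
  unfolding quadric_approx_def
proof (intro allI impI)
  fix z :: 'a assume z: "norm z \<le> \<rho> / 8"
  define a where "a = inv \<Phi> x"
  define v where "v = inv \<Phi> (x + z) - a"
  note inverse = near_identity_inverse(1)[OF \<Phi> \<epsilon>(1) B, folded a_def]
    near_identity_inverse(3-5)[OF \<Phi> \<epsilon>(1) B, of z, folded a_def, folded v_def]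
  have \<epsilon>0: "0 \<le> \<epsilon>" using inverse(1) norm_ge_zero order_trans by blast
  have \<rho>: "0 < \<rho>" using \<epsilon>0 \<epsilon>(2) by linarith
  have a: "a \<in> ball x \<rho>" using inverse(1) \<epsilon>(2) \<rho> by (simp add: dist_norm norm_minus_commute)
  have av: "a + v \<in> ball x \<rho>"
    using norm_triangle_ineq[of "a - x" v] inverse(1,2) \<epsilon>(2) z \<rho>
    by (simp add: dist_norm norm_minus_commute[of x] algebra_simps)
  have "\<bar>\<phi> (a + v) - (D\<phi> a v + Q v v / 2)\<bar> \<le> \<eta> / 2 * (norm z)\<^sup>2"
  proof -
    have "(norm v)\<^sup>2 \<le> (2 * norm z)\<^sup>2" using inverse(2) by (intro power_mono) auto
    then have "\<eta> / 8 * (norm v)\<^sup>2 \<le> \<eta> / 8 * (2 * norm z)\<^sup>2" using \<eta> by (intro mult_left_mono) auto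
    then show ?thesis using taylor[OF a av] zero
      by (simp add: a_def power_mult_distrib algebra_simps)
  qed
  moreover have "\<bar>(D\<phi> a v + Q v v / 2) - (D\<phi> a (B z) + Q z z / 2)\<bar> \<le> \<eta> / 2 * (norm z)\<^sup>2"
  proof -
    have "\<bar>(D\<phi> a v + Q v v / 2) - (D\<phi> a (B z) + Q z z / 2)\<bar> \<le> (8 * M + 3 * norm Q) * \<epsilon> * (norm z)\<^sup>2"
      using inverse L \<epsilon>0 by (intro abs_quadratic_expansion_le) (auto simp: a_def)
    also have "\<dots> \<le> \<eta> / 2 * (norm z)\<^sup>2" using \<epsilon>(3) by (intro mult_right_mono) auto
    finally show ?thesis .
  qed
  ultimately have "\<bar>\<phi> (a + v) - (D\<phi> a (B z) + Q z z / 2)\<bar> \<le> \<eta> * (norm z)\<^sup>2" by linarith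
  moreover have "x + z \<in> \<Phi> ` E \<longleftrightarrow> \<phi> (a + v) \<le> 0"
  proof -
    have "x + z \<in> \<Phi> ` E \<longleftrightarrow> a + v \<in> E"
      by (simp add: mem_bij_image_iff[OF \<Phi>(1)] v_def)
    then show ?thesis using E av by blast
  qed
  ultimately show "((D\<phi> (inv \<Phi> x) o\<^sub>L B) z + Q z z / 2 + \<eta> * (norm z)\<^sup>2 < 0 \<longrightarrow> x + z \<in> \<Phi> ` E) \<and>
      (x + z \<in> \<Phi> ` E \<longrightarrow> (D\<phi> (inv \<Phi> x) o\<^sub>L B) z + Q z z / 2 - \<eta> * (norm z)\<^sup>2 \<le> 0)"
    by (auto simp: a_def[symmetric] abs_le_iff)
qed

lemma tendsto_near_identityI:
  fixes f :: "'c \<Rightarrow> 'b::real_normed_vector"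
  assumes near: "\<And>\<epsilon>. \<epsilon> > 0 \<Longrightarrow> \<forall>\<^sub>F n in F. near_identity \<epsilon> (\<Phi> n)"
    and f: "\<And>n \<epsilon>. near_identity \<epsilon> (\<Phi> n) \<Longrightarrow> \<epsilon> \<le> 1/2 \<Longrightarrow> norm (f n - l) \<le> 2 * \<epsilon>"
  shows "(f \<longlongrightarrow> l) F"
proof (rule tendstoI)
  fix e :: real assume e: "e > 0"
  have "\<forall>\<^sub>F n in F. near_identity (min (1/2) (e / 3)) (\<Phi> n)" using e by (intro near) auto
  then show "\<forall>\<^sub>F n in F. dist (f n) l < e"
  proof eventually_elim
    case (elim n)
    then have "norm (f n - l) \<le> 2 * min (1/2) (e / 3)" by (rule f) simp
    then show ?case using e by (simp add: dist_norm)
  qed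
qed

definition quadric_expansion ::
  "('b \<Rightarrow> 'a::euclidean_space set) \<Rightarrow> 'a \<Rightarrow> ('b \<Rightarrow> 'a \<Rightarrow>\<^sub>L real) \<Rightarrow> ('a \<Rightarrow>\<^sub>L 'a \<Rightarrow>\<^sub>L real) \<Rightarrow> 'b filter \<Rightarrow> bool"
  where "quadric_expansion S x L Q F \<longleftrightarrow>
    (\<forall>\<eta>>0. \<exists>\<delta>>0. \<forall>\<^sub>F n in F. quadric_approx (S n) x \<delta> \<eta> (L n) Q)"

lemma quadric_expansion_near_identity:
  fixes x :: "'a::euclidean_space"
  assumes E: "local_defining E x \<rho> \<phi> D\<phi> D2\<phi>" "closed E" and front: "\<And>n. x \<in> frontier (\<Phi> n ` E)"
    and bij: "\<And>n. bij (\<Phi> n)" and near: "\<And>\<epsilon>. \<epsilon> > 0 \<Longrightarrow> \<forall>\<^sub>F n in F. near_identity \<epsilon> (\<Phi> n)"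
    and cont: "\<And>n. continuous_on UNIV (inv (\<Phi> n))"
    and B: "\<And>n. (inv (\<Phi> n) has_derivative blinfun_apply (B n)) (at x)"
    and lim: "((\<lambda>n. inv (\<Phi> n) x) \<longlongrightarrow> x) F" "((\<lambda>n. D\<phi> (inv (\<Phi> n) x)) \<longlongrightarrow> D\<phi> x) F"
  shows "quadric_expansion (\<lambda>n. \<Phi> n ` E) x (\<lambda>n. D\<phi> (inv (\<Phi> n) x) o\<^sub>L B n) (D2\<phi> x) F"
  unfolding quadric_expansion_def
proof (intro allI impI)
  fix \<eta> :: real assume \<eta>: "\<eta> > 0"
  obtain \<rho>' where \<rho>': "0 < \<rho>'" "\<rho>' \<le> \<rho>" and taylor: "\<And>a v. a \<in> ball x \<rho>' \<Longrightarrow> a + v \<in> ball x \<rho>' \<Longrightarrow>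
     \<bar>\<phi> (a + v) - \<phi> a - D\<phi> a v - D2\<phi> x v v / 2\<bar> \<le> \<eta> / 8 * (norm v)\<^sup>2"
    using local_defining_taylor[OF E(1), of "\<eta> / 8"] \<eta> by auto
  have E': "E \<inter> ball x \<rho>' = {y \<in> ball x \<rho>'. \<phi> y \<le> 0}"
    using E(1) subset_ball[OF \<rho>'(2), of x] unfolding local_defining_def by blast
  define M where "M = norm (D\<phi> x) + 1"
  define C where "C = 8 * M + 3 * norm (D2\<phi> x)"
  have C: "C > 0" by (simp add: C_def M_def add_nonneg_pos add_pos_nonneg)
  define \<epsilon> where "\<epsilon> = min (1/2) (min (\<rho>' / 3) (\<eta> / (2 * C)))"
  have "\<epsilon> > 0" "\<epsilon> \<le> 1/2" "\<epsilon> \<le> \<rho>' / 3" "\<epsilon> \<le> \<eta> / (2 * C)"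
    using \<rho>' \<eta> C by (auto simp: \<epsilon>_def)
  then have \<epsilon>: "\<epsilon> > 0" "\<epsilon> \<le> 1/2" "\<epsilon> < \<rho>' / 2" "C * \<epsilon> \<le> \<eta> / 2"
    using \<rho>' C by (auto simp: field_simps)
  have "\<forall>\<^sub>F n in F. norm (D\<phi> (inv (\<Phi> n) x)) < M"
    using order_tendstoD(2)[OF tendsto_norm[OF lim(2)], of M] by (simp add: M_def)
  moreover have "\<forall>\<^sub>F n in F. inv (\<Phi> n) x \<in> ball x \<rho>"
    using topological_tendstoD[OF lim(1), of "ball x \<rho>"] \<rho>' by simp
  ultimately have "\<forall>\<^sub>F n in F. quadric_approx (\<Phi> n ` E) x (\<rho>' / 8) \<eta> (D\<phi> (inv (\<Phi> n) x) o\<^sub>L B n) (D2\<phi> x)"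
    using near[OF \<epsilon>(1)]
  proof eventually_elim
    case (elim n)
    have zero: "\<phi> (inv (\<Phi> n) x) = 0"
      using inv_frontier_bij_image[OF bij cont front]
      by (rule local_defining_eq_0_frontier[OF E _ elim(2)])
    show ?case
      by (rule quadric_approx_near_identity_image[OF E' taylor bij elim(3) B zero less_imp_le[OF elim(1)]
            \<epsilon>(2,3) \<epsilon>(4)[unfolded C_def] less_imp_le[OF \<eta>]])
  qed
  then show "\<exists>\<delta>>0. \<forall>\<^sub>F n in F. quadric_approx (\<Phi> n ` E) x \<delta> \<eta> (D\<phi> (inv (\<Phi> n) x) o\<^sub>L B n) (D2\<phi> x)"
    using \<rho>'(1) by (intro exI[of _ "\<rho>' / 8"]) auto
qed

lemma convC_quadric_expansionE:
  fixes x :: "'a::euclidean_space"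
  assumes E: "local_defining E x \<rho> \<phi> D\<phi> D2\<phi>" "closed E" and "convC En E"
    and front: "\<And>n. x \<in> frontier (En n)"
  obtains L where "L \<longlonglongrightarrow> D\<phi> x" "quadric_expansion En x L (D2\<phi> x) sequentially"
proof -
  obtain \<Phi> where bij: "\<And>n. bij (\<Phi> n)" and im: "\<And>n. En n = \<Phi> n ` E"
    and C2: "\<And>n. C2_on UNIV (inv (\<Phi> n))"
    and near: "\<And>\<epsilon>. \<epsilon> > 0 \<Longrightarrow> \<forall>\<^sub>F n in sequentially. near_identity \<epsilon> (\<Phi> n)"
    using convCE[OF assms(3)] by blast
  have "\<exists>B. (inv (\<Phi> n) has_derivative blinfun_apply B) (at y)" for n y
    using C2[of n] unfolding C2_on_def by blast
  then obtain B where B: "\<And>n y. (inv (\<Phi> n) has_derivative blinfun_apply (B n y)) (at y)" by metis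
  have cont: "continuous_on UNIV (inv (\<Phi> n))" for n
    using has_derivative_continuous[OF B] by (simp add: continuous_at_imp_continuous_on)
  have inv_lim: "(\<lambda>n. inv (\<Phi> n) x) \<longlonglongrightarrow> x"
  proof (rule tendsto_near_identityI[OF near])
    show "norm (inv (\<Phi> n) x - x) \<le> 2 * \<epsilon>" if "near_identity \<epsilon> (\<Phi> n)" "\<epsilon> \<le> 1/2" for n \<epsilon>
      using near_identity_inverse(1)[OF bij that B[of n x]] norm_ge_zero[of "inv (\<Phi> n) x - x"]
      by linarith
  qed
  have B_lim: "(\<lambda>n. B n x) \<longlonglongrightarrow> id_blinfun"
    by (rule tendsto_near_identityI[OF near near_identity_inverse(2)[OF bij _ _ B]])
  have "isCont D\<phi> x"
    using E(1) unfolding local_defining_def by (meson centre_in_ball has_derivative_continuous)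
  then have D\<phi>_lim: "(\<lambda>n. D\<phi> (inv (\<Phi> n) x)) \<longlonglongrightarrow> D\<phi> x"
    using inv_lim by (rule isCont_tendsto_compose)
  have "(\<lambda>n. D\<phi> (inv (\<Phi> n) x) o\<^sub>L B n x) \<longlonglongrightarrow> (D\<phi> x o\<^sub>L id_blinfun)"
    using D\<phi>_lim B_lim by (intro tendsto_intros)
  also have "D\<phi> x o\<^sub>L id_blinfun = D\<phi> x" by (rule blinfun_eqI) simp
  finally show thesis
    using quadric_expansion_near_identity[OF E front[unfolded im] bij near cont B inv_lim D\<phi>_lim]
    by (intro that) (auto simp flip: im)
qed

lemma tendsto_gradient_of:
  assumes "(L \<longlongrightarrow> D) F" shows "((\<lambda>n. gradient_of (L n)) \<longlongrightarrow> gradient_of D) F"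
  unfolding gradient_of_def using assms
  by (intro tendsto_sum tendsto_scaleR tendsto_const blinfun.tendsto)

lemma tendsto_curv_formula:
  assumes "(L \<longlongrightarrow> D) F" "D \<noteq> 0"
  shows "((\<lambda>n. curv_formula (L n) Q) \<longlongrightarrow> curv_formula D Q) F"
  unfolding curv_formula_def Let_def using assms
  by (intro tendsto_intros blinfun.tendsto tendsto_gradient_of) (auto simp: gradient_of_eq_0_iff)

lemma tendsto_imbalance_error:
  fixes D :: "'a::euclidean_space \<Rightarrow>\<^sub>L real"
  assumes "(L \<longlongrightarrow> D) F" "(u \<longlongrightarrow> 0) F" "D \<noteq> 0"
  shows "((\<lambda>n. imbalance_error (L n) Q \<eta> (u n)) \<longlongrightarrow>
    2 * unit_ball_vol (real (DIM('a) - 1)) * (\<eta> / norm (gradient_of D))) F"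
proof -
  have "((\<lambda>n. imbalance_error (L n) Q \<eta> (u n)) \<longlongrightarrow> imbalance_error D Q \<eta> 0) F"
    unfolding imbalance_error_def using assms
    by (intro tendsto_intros tendsto_gradient_of) (auto simp: gradient_of_eq_0_iff)
  then show ?thesis by (simp add: imbalance_error_def)
qed

lemma eventually_imbalance_estimate:
  fixes x :: "'a::euclidean_space" and S :: "'b \<Rightarrow> 'a set"
  assumes d: "DIM('a) \<ge> 2" and S: "\<And>n. S n \<in> sets borel" and L: "(L \<longlongrightarrow> D) F" and D: "D \<noteq> 0"
    and expansion: "quadric_expansion S x L Q F" and \<eta>: "\<eta> > 0"
  shows "\<forall>\<^sub>F (n, u) in F \<times>\<^sub>F at_right 0.
    \<bar>imbalance x (S n) u / u ^ (DIM('a) + 1)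
        - unit_ball_vol (real (DIM('a) - 1)) / (real DIM('a) + 1) * curv_formula (L n) Q\<bar>
      \<le> imbalance_error (L n) Q \<eta> u"
proof -
  let ?G = "F \<times>\<^sub>F at_right (0::real)" and ?\<kappa> = "\<lambda>D. norm (gradient_of D)"
  have L': "((\<lambda>p. L (fst p)) \<longlongrightarrow> D) ?G" by (rule filterlim_compose[OF L filterlim_fst])
  have u_lim: "(snd \<longlongrightarrow> 0) ?G" by (rule filterlim_mono[OF filterlim_snd at_within_le_nhds order_refl])
  have "((\<lambda>p. snd p * ((norm Q / 2 + \<eta>) / ?\<kappa> (L (fst p)))) \<longlongrightarrow> 0 * ((norm Q / 2 + \<eta>) / ?\<kappa> D)) ?G"
    using D by (intro tendsto_intros tendsto_gradient_of u_lim L') (auto simp: gradient_of_eq_0_iff)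
  then have small: "\<forall>\<^sub>F p in ?G. snd p * ((norm Q / 2 + \<eta>) / ?\<kappa> (L (fst p))) < 1"
    by (rule order_tendstoD) simp
  have nonzero: "\<forall>\<^sub>F p in ?G. L (fst p) \<noteq> 0"
    using L' D by (rule tendsto_imp_eventually_ne)
  obtain \<delta> where \<delta>: "\<delta> > 0" "\<forall>\<^sub>F n in F. quadric_approx (S n) x \<delta> \<eta> (L n) Q"
    using expansion \<eta> unfolding quadric_expansion_def by blast
  have approx: "\<forall>\<^sub>F p in ?G. quadric_approx (S (fst p)) x \<delta> \<eta> (L (fst p)) Q"
    using \<delta>(2) filterlim_fst by (rule eventually_compose_filterlim)
  have u: "\<forall>\<^sub>F p in ?G. snd p \<in> {0<..<\<delta>}"
    using eventually_at_right_real[OF \<delta>(1)] filterlim_snd by (rule eventually_compose_filterlim)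
  show ?thesis
    using small nonzero approx u
  proof eventually_elim
    case (elim p)
    obtain n u where p: "p = (n, u)" by (cases p)
    have "quadric_approx (S n) x u \<eta> (L n) Q"
      using elim(3,4) by (auto simp: p intro: quadric_approx_mono)
    then show ?case
      unfolding p prod.case using elim \<eta> by (intro imbalance_estimate[OF d S]) (simp_all add: p)
  qed
qed

lemma tendsto_imbalance_ratio:
  fixes x :: "'a::euclidean_space" and S :: "'b \<Rightarrow> 'a set"
  assumes d: "DIM('a) \<ge> 2" and S: "\<And>n. S n \<in> sets borel" and L: "(L \<longlongrightarrow> D) F" and D: "D \<noteq> 0"
    and expansion: "quadric_expansion S x L Q F"
  shows "((\<lambda>(n, u). imbalance x (S n) u / u ^ (DIM('a) + 1)) \<longlongrightarrow>
      unit_ball_vol (real (DIM('a) - 1)) / (real DIM('a) + 1) * curv_formula D Q) (F \<times>\<^sub>F at_right 0)"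
proof (rule tendstoI)
  let ?G = "F \<times>\<^sub>F at_right (0::real)"
  define \<omega> where "\<omega> = unit_ball_vol (real (DIM('a) - 1))"
  have \<omega>: "\<omega> > 0" by (simp add: \<omega>_def)
  define c where "c D = \<omega> / (real DIM('a) + 1) * curv_formula D Q" for D
  fix e :: real assume e: "e > 0"
  define \<eta> where "\<eta> = e * norm (gradient_of D) / (4 * \<omega>)"
  have \<eta>: "\<eta> > 0" using e \<omega> D by (simp add: \<eta>_def gradient_of_eq_0_iff)
  have L': "((\<lambda>p. L (fst p)) \<longlongrightarrow> D) ?G" by (rule filterlim_compose[OF L filterlim_fst])
  have u_lim: "(snd \<longlongrightarrow> 0) ?G" by (rule filterlim_mono[OF filterlim_snd at_within_le_nhds order_refl])
  have "2 * \<omega> * (\<eta> / norm (gradient_of D)) = e / 2"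
    using \<omega> D by (simp add: \<eta>_def gradient_of_eq_0_iff)
  then have "((\<lambda>p. imbalance_error (L (fst p)) Q \<eta> (snd p)) \<longlongrightarrow> e / 2) ?G"
    using tendsto_imbalance_error[OF L' u_lim D, of Q \<eta>] by (simp only: \<omega>_def)
  then have error: "\<forall>\<^sub>F p in ?G. imbalance_error (L (fst p)) Q \<eta> (snd p) < 3 / 4 * e"
    using e by (intro order_tendstoD(2)) auto
  have "((\<lambda>p. c (L (fst p))) \<longlongrightarrow> c D) ?G"
    unfolding c_def by (intro tendsto_mult_left tendsto_curv_formula L' D)
  then have coeff: "\<forall>\<^sub>F p in ?G. dist (c (L (fst p))) (c D) < 1 / 4 * e"
    using e by (intro tendstoD) auto
  have "\<forall>\<^sub>F p in ?G. dist (case p of (n, u) \<Rightarrow> imbalance x (S n) u / u ^ (DIM('a) + 1)) (c D) < e"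
    using error coeff
      eventually_imbalance_estimate[OF d S L D expansion \<eta>, folded \<omega>_def, folded c_def]
  proof eventually_elim
    case (elim p)
    obtain n u where "p = (n, u)" by (cases p)
    then show ?case using elim unfolding dist_real_def by (simp only: prod.case fst_conv snd_conv)
  qed
  then show "\<forall>\<^sub>F p in ?G. dist (case p of (n, u) \<Rightarrow> imbalance x (S n) u / u ^ (DIM('a) + 1))
      (unit_ball_vol (real (DIM('a) - 1)) / (real DIM('a) + 1) * curv_formula D Q) < e"
    unfolding c_def \<omega>_def .
qed

subsection \<open>The limit\<close>

lemma mean_curvE:
  assumes "E \<in> classC" "x \<in> frontier E"
  obtains \<rho> \<phi> D\<phi> D2\<phi>
  where "local_defining E x \<rho> \<phi> D\<phi> D2\<phi>" "mean_curv x E = curv_formula (D\<phi> x) (D2\<phi> x)"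
proof -
  have "\<exists>K \<rho> \<phi> D\<phi> D2\<phi>. local_defining E x \<rho> \<phi> D\<phi> D2\<phi> \<and> K = curv_formula (D\<phi> x) (D2\<phi> x)"
    using assms by (auto simp: classC_def)
  from someI_ex[OF this] show thesis
    unfolding mean_curv_def[symmetric] using that by blast
qed

theorem theorem5p7:
  fixes r s :: "nat \<Rightarrow> real" and En :: "nat \<Rightarrow> 'a::euclidean_space set" and E :: "'a set" and x :: 'a
  assumes "DIM('a) \<ge> 2"
    and "\<And>n. 0 < r n \<and> r n < 1"
    and "\<And>n. 1 < s n"
    and "r \<longlonglongrightarrow> 0"
    and "s \<longlonglongrightarrow> 1"
    and "\<And>n. En n \<in> classC"
    and "E \<in> classC"
    and "convC En E"
    and "\<And>n. x \<in> frontier E \<inter> frontier (En n)"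
  shows "(\<lambda>n. Kcurv (s n) (r n) x (En n) / beta DIM('a) (r n) (s n))
           \<longlonglongrightarrow> unit_ball_vol (real (DIM('a) - 1)) * mean_curv x E"
proof -
  have closed: "closed E" and borel: "En n \<in> sets borel" for n
    using assms(6)[of n] assms(7) by (auto simp: classC_def)
  have front: "x \<in> frontier E" "x \<in> frontier (En n)" for n using assms(9) by auto
  obtain \<rho> \<phi> D\<phi> D2\<phi> where E: "local_defining E x \<rho> \<phi> D\<phi> D2\<phi>"
    and curv: "mean_curv x E = curv_formula (D\<phi> x) (D2\<phi> x)"
    using mean_curvE[OF assms(7) front(1)] .
  have "D\<phi> x \<noteq> 0" using E by (simp add: local_defining_def)
  obtain L where L: "L \<longlonglongrightarrow> D\<phi> x"
    and expansion: "quadric_expansion En x L (D2\<phi> x) sequentially"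
    using convC_quadric_expansionE[OF E closed assms(8) front(2)] .
  note imbalance = tendsto_imbalance_ratio[OF assms(1) borel L \<open>D\<phi> x \<noteq> 0\<close> expansion, folded curv]
  have "real DIM('a) + 1 \<noteq> 0" by linarith
  then show ?thesis
    using Kcurv_asymptotics[OF borel assms(2,4,3,5) imbalance] by simp
qed

end
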